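(* Let $f\in H_0^1(-1,1)$, $f\not\equiv 0$, and let $B>\omega(f)$. Then $$\|f\|_{L^2(-1,1)} \leq \left(1-\frac{\omega(f)^2}{B^2}\right)^{-1/2}\|F_Bf\|_{L^2(-B,B)}.$$ In particular, if $\gamma>1$ and $B\geq\sqrt{\gamma}\,\omega(f)$, then $$\|f\|_{L^2(-1,1)}\leq C_\gamma\|F_Bf\|_{L^2(-B,B)},\qquad C_\gamma=\left(1-\frac1\gamma\right)^{-1/2}.$$
   Context: Functions $f$ are real-valued. $H_0^1(-1,1)=\{f\in H^1(-1,1): f(-1)=f(1)=0\}$; its elements are extended by zero to $\mathbb{R}$ and $f_x$ denotes the weak derivative. The Fourier transform of $f\in L^2(-1,1)$ is $\widehat f(\xi)=\frac{1}{\sqrt{2\pi}}\int_{-1}^1 f(x)e^{-ix\xi}\,dx$, $\xi\in\mathbb{R}$. For $B>0$ the truncated Fourier transform is $F_Bf(\xi)=\chi_{[-B,B]}(\xi)\widehat f(\xi)$, where $\chi_{[-B,B]}$ is the characteristic function of $[-B,B]$. The frequency number of a nonzero $f\in H_0^1(-1,1)$ is $\omega(f)=\|f_x\|_{L^2(-1,1)}/\|f\|_{L^2(-1,1)}$. *)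

theory Defs
  imports "HOL-Analysis.Analysis"
begin

text \<open>
  Elements of \<open>L\<^sup>2(S)\<close> are represented by functions on the whole line. All notions below depend only
  on the almost-everywhere class of the restriction to \<open>S\<close>, so the values off \<open>S\<close> play no role.
\<close>

definition L2_space :: "real set \<Rightarrow> (real \<Rightarrow> real) set" where
  "L2_space S = {f \<in> borel_measurable (lebesgue_on S).
     integrable (lebesgue_on S) (\<lambda>x. (f x)\<^sup>2)}"

definition L2_norm_on :: "real set \<Rightarrow> (real \<Rightarrow> 'a::real_normed_vector) \<Rightarrow> real" where
  "L2_norm_on S f = sqrt (\<integral>x. (norm (f x))\<^sup>2 \<partial>lebesgue_on S)"

definition test_function :: "real set \<Rightarrow> (real \<Rightarrow> real) \<Rightarrow> bool" where
  "test_function S \<phi> \<longleftrightarrow>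
     (\<forall>n x. (deriv ^^ n) \<phi> field_differentiable at x) \<and>
     compact (closure {x. \<phi> x \<noteq> 0}) \<and> closure {x. \<phi> x \<noteq> 0} \<subseteq> S"

definition has_L2_weak_deriv :: "real set \<Rightarrow> (real \<Rightarrow> real) \<Rightarrow> (real \<Rightarrow> real) \<Rightarrow> bool" where
  "has_L2_weak_deriv S f g \<longleftrightarrow> f \<in> L2_space S \<and> g \<in> L2_space S \<and>
     (\<forall>\<phi>. test_function S \<phi> \<longrightarrow>
        (\<integral>x. f x * deriv \<phi> x \<partial>lebesgue_on S) = - (\<integral>x. g x * \<phi> x \<partial>lebesgue_on S))"

definition sobolev_H1 :: "real set \<Rightarrow> (real \<Rightarrow> real) set" where
  "sobolev_H1 S = {f. \<exists>g. has_L2_weak_deriv S f g}"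

text \<open>For open \<open>S\<close> the weak derivative is unique up to null sets, so the choice is harmless.\<close>

definition weak_deriv :: "real set \<Rightarrow> (real \<Rightarrow> real) \<Rightarrow> real \<Rightarrow> real" where
  "weak_deriv S f = (SOME g. has_L2_weak_deriv S f g)"

text \<open>The boundary values of \<open>f\<close> are those of its continuous representative on \<open>[a, b]\<close>.\<close>

definition sobolev_H10 :: "real \<Rightarrow> real \<Rightarrow> (real \<Rightarrow> real) set" where
  "sobolev_H10 a b = {f \<in> sobolev_H1 {a<..<b}.
     \<exists>u. continuous_on {a..b} u \<and> (AE x in lebesgue_on {a<..<b}. f x = u x) \<and>
         u a = 0 \<and> u b = 0}"

definition fourier :: "(real \<Rightarrow> real) \<Rightarrow> real \<Rightarrow> complex" where
  "fourier f \<xi> = complex_of_real (1 / sqrt (2 * pi)) *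
     (\<integral>x. complex_of_real (f x) * exp (- \<i> * complex_of_real (x * \<xi>)) \<partial>lebesgue_on {-1<..<1})"

definition truncated_fourier :: "real \<Rightarrow> (real \<Rightarrow> real) \<Rightarrow> real \<Rightarrow> complex" where
  "truncated_fourier B f \<xi> = indicator {-B..B} \<xi> * fourier f \<xi>"

definition frequency_number :: "(real \<Rightarrow> real) \<Rightarrow> real" where
  "frequency_number f =
     L2_norm_on {-1<..<1} (weak_deriv {-1<..<1} f) / L2_norm_on {-1<..<1} f"

definition C_const :: "real \<Rightarrow> real" where
  "C_const \<gamma> = (1 - 1 / \<gamma>) powr (- 1 / 2)"

end

theory Submission
  imports Defs "HOL-Probability.Characteristic_Functions"
begin

text \<open>
  Write \<open>g\<close> for the weak derivative of \<open>f\<close> and \<open>\<omega>\<close> for the frequency number. Since \<open>f\<close> vanishes at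
  the end points, the Fourier transform of \<open>g\<close> is \<open>\<i> \<xi>\<close> times that of \<open>f\<close>
  (\<open>fourier_weak_deriv\<close>). Frequencies with \<open>|\<xi>| \<ge> B\<close> therefore carry at most \<open>B\<^sup>-\<^sup>2\<close> times the
  energy of \<open>g\<close>, and Plancherel's theorem gives
  \<open>\<parallel>f\<parallel>\<^sup>2 \<le> \<parallel>F\<^sub>B f\<parallel>\<^sup>2 + \<parallel>g\<parallel>\<^sup>2/B\<^sup>2 = \<parallel>F\<^sub>B f\<parallel>\<^sup>2 + \<omega>\<^sup>2 \<parallel>f\<parallel>\<^sup>2/B\<^sup>2\<close>
  (\<open>L2_norm_le_low_frequencies\<close>), which is the first claim. The second one follows because
  \<open>\<omega>\<^sup>2/B\<^sup>2 \<le> 1/\<gamma>\<close>; here \<open>B > 0\<close> because \<open>\<omega> > 0\<close>.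

  The Fourier identity amounts to testing the weak derivative against \<open>cos(\<xi>x)\<close> and \<open>sin(\<xi>x)\<close>, which
  are not compactly supported in \<open>(-1, 1)\<close>. They are multiplied by smooth cutoffs of bounded
  variation whose derivatives concentrate at the end points, where the continuous representative of
  \<open>f\<close> is small (\<open>weak_deriv_smooth\<close>).

  Only two halves of Plancherel's theorem are needed, both for the energy with a Gaussian weight
  \<open>exp(-\<xi>\<^sup>2/(2n\<^sup>2))\<close>. Fubini's theorem and the characteristic function of the normal distribution turn
  this energy into the double integral of \<open>h(x) h(y) K(x - y)\<close>, where \<open>K\<close> is the normal density with
  standard deviation \<open>1/n\<close> (\<open>gauss_energy_eq\<close>). It is at most \<open>\<parallel>h\<parallel>\<^sup>2\<close> for every \<open>h\<close> in \<open>L\<^sup>2\<close>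
  (\<open>gauss_energy_le\<close>, applied to \<open>g\<close>), and tends to \<open>\<parallel>h\<parallel>\<^sup>2\<close> if \<open>h\<close> is continuous up to the boundary
  (\<open>gauss_energy_tendsto\<close>, applied to \<open>f\<close>).
\<close>

section \<open>Smooth functions of one real variable\<close>

text \<open>
  The \<open>k\<close>-fold differentiability of \<open>f\<close> everywhere, by recursion on \<open>k\<close> and with an
  existentially quantified derivative. In this form closure under products and composition is a plain induction on
  \<open>k\<close>, with no Leibniz or Faa di Bruno formula.
\<close>

primrec times_differentiable :: "nat \<Rightarrow> (real \<Rightarrow> real) \<Rightarrow> bool" where
  "times_differentiable 0 f \<longleftrightarrow> True"
| "times_differentiable (Suc k) f \<longleftrightarrow>
     (\<exists>f'. (\<forall>x. (f has_real_derivative f' x) (at x)) \<and> times_differentiable k f')"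

text \<open>
  Infinite differentiability on the whole line.
\<close>

definition smooth :: "(real \<Rightarrow> real) \<Rightarrow> bool" where
  "smooth f \<longleftrightarrow> (\<forall>k. times_differentiable k f)"

lemma times_differentiable_SucD: "times_differentiable (Suc k) f \<Longrightarrow> times_differentiable k f"
proof (induction k arbitrary: f)
  case (Suc k)
  then obtain f' where "\<And>x. (f has_real_derivative f' x) (at x)" "times_differentiable (Suc k) f'"
    by (subst (asm) times_differentiable.simps(2)) blast
  with Suc.IH show ?case
    by auto
qed simp

lemma times_differentiable_const: "times_differentiable k (\<lambda>x. c)"
  by (induction k arbitrary: c) (auto intro!: exI[of _ "\<lambda>x. 0"])

lemma times_differentiable_ident: "times_differentiable k (\<lambda>x. x)"
  by (cases k) (auto intro!: exI[of _ "\<lambda>x. 1"] times_differentiable_const)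

lemma times_differentiable_add:
  "times_differentiable k f \<Longrightarrow> times_differentiable k g \<Longrightarrow> times_differentiable k (\<lambda>x. f x + g x)"
proof (induction k arbitrary: f g)
  case (Suc k)
  then obtain f' g' where "\<And>x. (f has_real_derivative f' x) (at x)" "times_differentiable k f'"
    "\<And>x. (g has_real_derivative g' x) (at x)" "times_differentiable k g'"
    by auto
  then show ?case
    using Suc.IH by (auto intro!: exI[of _ "\<lambda>x. f' x + g' x"] DERIV_add)
qed simp

lemma times_differentiable_mult:
  "times_differentiable k f \<Longrightarrow> times_differentiable k g \<Longrightarrow> times_differentiable k (\<lambda>x. f x * g x)"
proof (induction k arbitrary: f g)
  case (Suc k)
  then obtain f' g' where *: "\<And>x. (f has_real_derivative f' x) (at x)" "times_differentiable k f'"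
    "\<And>x. (g has_real_derivative g' x) (at x)" "times_differentiable k g'"
    by auto
  have "times_differentiable k (\<lambda>x. f' x * g x + g' x * f x)"
    using * Suc.prems[THEN times_differentiable_SucD] by (intro times_differentiable_add Suc.IH)
  with * show ?case
    by (auto intro!: exI[of _ "\<lambda>x. f' x * g x + g' x * f x"] DERIV_mult)
qed simp

lemma times_differentiable_compose:
  "times_differentiable k f \<Longrightarrow> times_differentiable k g \<Longrightarrow> times_differentiable k (\<lambda>x. f (g x))"
proof (induction k arbitrary: f g)
  case (Suc k)
  then obtain f' g' where *: "\<And>x. (f has_real_derivative f' x) (at x)" "times_differentiable k f'"
    "\<And>x. (g has_real_derivative g' x) (at x)" "times_differentiable k g'"
    by auto
  have "times_differentiable k (\<lambda>x. f' (g x) * g' x)"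
    using * Suc.prems[THEN times_differentiable_SucD] by (intro times_differentiable_mult Suc.IH[of f' g])
  with * show ?case
    by (auto intro!: exI[of _ "\<lambda>x. f' (g x) * g' x"] DERIV_chain2[of f _ g])
qed simp

lemma times_differentiable_sin_cos:
  "times_differentiable k (\<lambda>x. a * sin x + b * cos x)"
proof (induction k arbitrary: a b)
  case (Suc k)
  show ?case
    using Suc[of "-b" a]
    by (auto intro!: exI[of _ "\<lambda>x. - b * sin x + a * cos x"] derivative_eq_intros)
qed simp

lemma smooth_const: "smooth (\<lambda>x. c)"
  and smooth_ident: "smooth (\<lambda>x. x)"
  and smooth_add: "smooth f \<Longrightarrow> smooth g \<Longrightarrow> smooth (\<lambda>x. f x + g x)"
  and smooth_mult: "smooth f \<Longrightarrow> smooth g \<Longrightarrow> smooth (\<lambda>x. f x * g x)"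
  and smooth_compose: "smooth f \<Longrightarrow> smooth g \<Longrightarrow> smooth (\<lambda>x. f (g x))"
  by (simp_all add: smooth_def times_differentiable_const times_differentiable_ident
      times_differentiable_add times_differentiable_mult times_differentiable_compose)

lemma smooth_sin: "smooth sin" and smooth_cos: "smooth cos"
  using times_differentiable_sin_cos[of _ 1 0] times_differentiable_sin_cos[of _ 0 1]
  by (simp_all add: smooth_def)

lemma smooth_imp_higher_deriv_differentiable:
  assumes "smooth f"
  shows "(deriv ^^ n) f field_differentiable at x"
proof -
  have "times_differentiable (n + k) f \<Longrightarrow> times_differentiable k ((deriv ^^ n) f)" for k
  proof (induction n arbitrary: f)
    case (Suc n)
    then obtain f' where f': "\<And>x. (f has_real_derivative f' x) (at x)" "times_differentiable (n + k) f'"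
      by auto
    then have "deriv f = f'"
      by (auto intro!: DERIV_imp_deriv)
    with f' Suc.IH[of f'] show ?case
      by (simp only: funpow_Suc_right o_def)
  qed simp
  from this[of 1] have "times_differentiable 1 ((deriv ^^ n) f)"
    using assms by (simp only: smooth_def)
  then show ?thesis
    by (auto simp: field_differentiable_def)
qed

lemma smooth_DERIV:
  assumes "smooth f"
  shows "(f has_real_derivative deriv f x) (at x)"
  using smooth_imp_higher_deriv_differentiable[OF assms, of 0 x]
  by (simp add: DERIV_deriv_iff_field_differentiable)

lemma smooth_imp_continuous_deriv:
  assumes "smooth f"
  shows "continuous_on A (deriv f)"
  using smooth_imp_higher_deriv_differentiable[OF assms, of 1]
  by (auto intro!: continuous_at_imp_continuous_on field_differentiable_imp_continuous_at)

section \<open>Smooth cutoff functions on the interval\<close>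

text \<open>
  The functions \<open>p(1/x) exp(-1/x)\<close> for \<open>x > 0\<close>, extended by \<open>0\<close>. The polynomial \<open>p\<close> makes the
  family closed under differentiation, so that all its members are smooth; \<open>flat 1\<close> is the usual
  smooth function that vanishes exactly on the negative half-line and \<open>0\<close>.
\<close>

definition flat :: "real poly \<Rightarrow> real \<Rightarrow> real" where
  "flat p x = (if x > 0 then poly p (1 / x) * exp (- (1 / x)) else 0)"

lemma poly_exp_tendsto_0: "((\<lambda>y::real. poly p y * exp (- y)) \<longlongrightarrow> 0) at_top"
proof -
  have "((\<lambda>y. y ^ k * (poly p y * exp (- y))) \<longlongrightarrow> 0) at_top" for k
  proof (induction p arbitrary: k)
    case (pCons a p)
    have "((\<lambda>y. a * (y ^ k / exp y) + y ^ Suc k * (poly p y * exp (- y))) \<longlongrightarrow> a * 0 + 0) at_top"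
      by (intro tendsto_add tendsto_mult tendsto_const tendsto_power_div_exp_0 pCons.IH)
    then show ?case
      by (simp add: algebra_simps exp_minus divide_inverse)
  qed simp
  from this[of 0] show ?thesis by simp
qed

lemma DERIV_flat: "(flat p has_real_derivative flat ([:0, 0, 1:] * (p - pderiv p)) x) (at x)"
proof -
  consider "x > 0" | "x < 0" | "x = 0" by linarith
  then show ?thesis
  proof cases
    case 1
    have "((\<lambda>x. poly p (1 / x) * exp (- (1 / x))) has_real_derivative
        flat ([:0, 0, 1:] * (p - pderiv p)) x) (at x)"
      using 1 by (auto intro!: derivative_eq_intros DERIV_chain2[OF poly_DERIV]
          simp: flat_def field_simps power2_eq_square)
    then show ?thesis
      by (rule has_field_derivative_transform_within_open[of _ _ _ "{0<..}"])
        (use 1 in \<open>auto simp: flat_def\<close>)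
  next
    case 2
    have "((\<lambda>x. 0) has_real_derivative flat ([:0, 0, 1:] * (p - pderiv p)) x) (at x)"
      using 2 by (simp add: flat_def)
    then show ?thesis
      by (rule has_field_derivative_transform_within_open[of _ _ _ "{..<0}"])
        (use 2 in \<open>auto simp: flat_def\<close>)
  next
    case 3
    \<comment> \<open>With \<open>y = 1/h\<close> the difference quotient from the right is \<open>y p(y) exp(-y)\<close>.\<close>
    have "((\<lambda>h. (flat p h - flat p 0) / (h - 0)) \<longlongrightarrow> 0) (at_right 0)"
    proof -
      have "((\<lambda>y. poly (pCons 0 p) y * exp (- y)) \<longlongrightarrow> 0) at_top"
        by (rule poly_exp_tendsto_0)
      then have "((\<lambda>y. (flat p (inverse y) - flat p 0) / (inverse y - 0)) \<longlongrightarrow> 0) at_top"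
        by (rule Lim_transform_eventually)
          (auto intro!: eventually_mono[OF eventually_gt_at_top[of 0]] simp: flat_def divide_inverse)
      then show ?thesis
        by (simp add: filterlim_at_right_to_top)
    qed
    moreover have "((\<lambda>h. (flat p h - flat p 0) / (h - 0)) \<longlongrightarrow> 0) (at_left 0)"
      by (rule Lim_transform_eventually[OF tendsto_const])
        (auto simp: eventually_at_filter flat_def)
    ultimately have "((\<lambda>h. (flat p h - flat p 0) / (h - 0)) \<longlongrightarrow> 0) (at 0)"
      by (simp add: filterlim_at_split)
    then show ?thesis
      by (simp add: 3 has_field_derivative_iff flat_def)
  qed
qed

lemma smooth_flat: "smooth (flat p)"
proof -
  have "times_differentiable k (flat p)" for k
    by (induction k arbitrary: p) (auto intro: DERIV_flat)
  then show ?thesis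
    by (simp add: smooth_def)
qed

text \<open>
  With \<open>r = 1 - 1/m\<close>, \<open>cutoff m\<close> is the bump \<open>exp(-1/(m(r\<^sup>2 - x\<^sup>2)))\<close> supported in \<open>[-r, r]\<close>. As
  \<open>m\<close> grows the exponent tends to \<open>0\<close> at every point of \<open>(-1, 1)\<close>; hence the bumps converge to \<open>1\<close>
  there without having to be constant anywhere.
\<close>

definition cutoff :: "real \<Rightarrow> real \<Rightarrow> real" where
  "cutoff m x = flat 1 (m * ((1 - 1 / m)\<^sup>2 - x\<^sup>2))"

lemma smooth_cutoff: "smooth (cutoff m)"
proof -
  have "smooth (\<lambda>x. flat 1 (m * ((1 - 1 / m)\<^sup>2 + (-1) * (x * x))))"
    by (intro smooth_compose[OF smooth_flat] smooth_mult smooth_add smooth_const smooth_ident)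
  then show ?thesis
    by (simp add: cutoff_def[abs_def] power2_eq_square[of "_ :: real"])
qed

lemma cutoff_nonneg: "0 \<le> cutoff m x" and cutoff_le_1: "cutoff m x \<le> 1"
  by (auto simp: cutoff_def flat_def)

lemma cutoff_eq_0:
  assumes "m \<ge> 1" "\<bar>x\<bar> > 1 - 1 / m"
  shows "cutoff m x = 0"
proof -
  have "(1 - 1 / m)\<^sup>2 \<le> \<bar>x\<bar>\<^sup>2"
    using assms by (intro power_mono) auto
  then have "m * ((1 - 1 / m)\<^sup>2 - x\<^sup>2) \<le> 0"
    using assms by (intro mult_nonneg_nonpos) auto
  then show ?thesis
    by (simp add: cutoff_def flat_def)
qed

lemma test_function_cutoff_mult:
  assumes "m \<ge> 1" "smooth \<phi>"
  shows "test_function {-1<..<1} (\<lambda>x. cutoff m x * \<phi> x)"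
proof -
  have "x \<in> {-(1 - 1/m)..1 - 1/m}" if "cutoff m x * \<phi> x \<noteq> 0" for x
    using that cutoff_eq_0[OF assms(1), of x] by (cases "\<bar>x\<bar> > 1 - 1 / m") auto
  then have "{x. cutoff m x * \<phi> x \<noteq> 0} \<subseteq> {-(1 - 1/m)..1 - 1/m}"
    by blast
  then have sub: "closure {x. cutoff m x * \<phi> x \<noteq> 0} \<subseteq> {-(1 - 1/m)..1 - 1/m}"
    by (rule closure_minimal) simp
  also have "\<dots> \<subseteq> {-1<..<1}"
  proof -
    have "{-r..r} \<subseteq> {-1<..<1}" if "r < 1" for r :: real
      using that by auto
    from this[of "1 - 1 / m"] assms(1) show ?thesis
      by simp
  qed
  finally have "closure {x. cutoff m x * \<phi> x \<noteq> 0} \<subseteq> {-1<..<1}" .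
  moreover have "compact (closure {x. cutoff m x * \<phi> x \<noteq> 0})"
    using bounded_subset[OF bounded_closed_interval sub] by (simp add: compact_eq_bounded_closed)
  moreover have "smooth (\<lambda>x. cutoff m x * \<phi> x)"
    by (intro smooth_mult smooth_cutoff assms)
  ultimately show ?thesis
    using smooth_imp_higher_deriv_differentiable by (auto simp: test_function_def)
qed

lemma cutoff_tendsto_1:
  assumes "\<bar>x\<bar> < 1"
  shows "(\<lambda>n. cutoff (real (Suc n)) x) \<longlonglongrightarrow> 1"
proof -
  have "(\<lambda>n. 1 - 1 / real (Suc n)) \<longlonglongrightarrow> 1"
    using tendsto_diff[OF tendsto_const LIMSEQ_inverse_real_of_nat, of 1] by (simp add: divide_inverse)
  then have lim: "(\<lambda>n. (1 - 1 / real (Suc n))\<^sup>2 - x\<^sup>2) \<longlonglongrightarrow> 1\<^sup>2 - x\<^sup>2"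
    by (intro tendsto_intros)
  have pos: "1\<^sup>2 - x\<^sup>2 > 0"
    using assms by (simp add: abs_square_less_1)
  have top: "filterlim (\<lambda>n. real (Suc n) * ((1 - 1 / real (Suc n))\<^sup>2 - x\<^sup>2)) at_top sequentially"
    by (rule filterlim_at_top_mult_tendsto_pos[OF lim pos])
      (rule filterlim_compose[OF filterlim_real_sequentially filterlim_Suc])
  have "((\<lambda>y::real. exp (- inverse y)) \<longlongrightarrow> exp (-0)) at_top"
    by (intro tendsto_intros tendsto_inverse_0_at_top filterlim_ident)
  then have "((\<lambda>y. flat 1 y) \<longlongrightarrow> 1) at_top"
    by (auto intro!: Lim_transform_eventually[where f="\<lambda>y::real. exp (- inverse y)"]
        eventually_mono[OF eventually_gt_at_top[of 0]] simp: flat_def divide_inverse)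
  from filterlim_compose[OF this top] show ?thesis
    by (simp add: cutoff_def)
qed

lemma DERIV_cutoff:
  "(cutoff m has_real_derivative - 2 * m * x * flat [:0, 0, 1:] (m * ((1 - 1 / m)\<^sup>2 - x\<^sup>2))) (at x)"
proof -
  have "((\<lambda>x. m * ((1 - 1 / m)\<^sup>2 - x\<^sup>2)) has_real_derivative - 2 * m * x) (at x)"
    by (auto intro!: derivative_eq_intros)
  from DERIV_chain2[OF DERIV_flat[of 1] this] show ?thesis
    by (simp add: cutoff_def[abs_def] mult_ac)
qed

lemma deriv_cutoff:
  "deriv (cutoff m) x = - 2 * m * x * flat [:0, 0, 1:] (m * ((1 - 1 / m)\<^sup>2 - x\<^sup>2))"
  by (rule DERIV_imp_deriv[OF DERIV_cutoff])

lemma flat_nonneg: "0 \<le> flat [:0, 0, 1:] y"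
  by (simp add: flat_def)

lemma flat_le: "flat [:0, 0, 1:] y \<le> 1 / y\<^sup>2"
  by (simp add: flat_def power2_eq_square divide_right_mono)

text \<open>
  The cutoff increases on \<open>[-1, 0]\<close> and decreases on \<open>[0, 1]\<close>, with values between \<open>0\<close> and \<open>1\<close>, so
  its total variation is at most \<open>2\<close>, uniformly in \<open>m\<close>.
\<close>

lemma integral_abs_deriv_cutoff:
  assumes "m \<ge> 1"
  shows "integral {-1..1} (\<lambda>x. \<bar>deriv (cutoff m) x\<bar>) \<le> 2"
proof -
  let ?d = "deriv (cutoff m)"
  have ivl: "(\<lambda>x. \<bar>?d x\<bar>) integrable_on {a..b}" for a b
    by (intro integrable_continuous_real continuous_intros smooth_imp_continuous_deriv smooth_cutoff)
  have FTC: "(?d has_integral (cutoff m b - cutoff m a)) {a..b}" if "a \<le> b" for a b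
    using that smooth_DERIV[OF smooth_cutoff]
    by (intro fundamental_theorem_of_calculus)
      (auto simp: has_real_derivative_iff_has_vector_derivative[symmetric] intro: has_field_derivative_at_within)
  have "integral {-1..0} (\<lambda>x. \<bar>?d x\<bar>) = integral {-1..0} ?d"
    using assms flat_nonneg by (intro Henstock_Kurzweil_Integration.integral_cong)
      (auto simp: deriv_cutoff abs_mult)
  also have "\<dots> \<le> 1"
    using integral_unique[OF FTC[of "-1" 0]] cutoff_nonneg[of m "-1"] cutoff_le_1[of m 0] by simp
  finally have 1: "integral {-1..0} (\<lambda>x. \<bar>?d x\<bar>) \<le> 1" .
  have "integral {0..1} (\<lambda>x. \<bar>?d x\<bar>) = integral {0..1} (\<lambda>x. - ?d x)"
    using assms flat_nonneg by (intro Henstock_Kurzweil_Integration.integral_cong)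
      (auto simp: deriv_cutoff abs_mult)
  also have "\<dots> \<le> 1"
    using integral_unique[OF has_integral_neg[OF FTC[of 0 1]]] cutoff_nonneg[of m 1] cutoff_le_1[of m 0] by simp
  finally have 2: "integral {0..1} (\<lambda>x. \<bar>?d x\<bar>) \<le> 1" .
  show ?thesis
    using 1 2 Henstock_Kurzweil_Integration.integral_combine[of "-1" 0 1 "\<lambda>x. \<bar>?d x\<bar>", OF _ _ ivl]
    by simp
qed

section \<open>The weak derivative tested against functions without compact support\<close>

abbreviation I1 :: "real set" where "I1 \<equiv> {-1<..<1}"

lemma finite_measure_I1: "finite_measure (lebesgue_on I1)"
  by (intro finite_measure_lebesgue_on lmeasurable_open) auto

lemma measure_I1: "measure (lebesgue_on I1) (space (lebesgue_on I1)) = 2"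
  by (simp add: measure_restrict_space)

lemma integrable_bounded_I1:
  fixes f :: "real \<Rightarrow> 'b::{banach, second_countable_topology}"
  assumes "f \<in> borel_measurable (lebesgue_on I1)" "\<And>x. x \<in> I1 \<Longrightarrow> norm (f x) \<le> C"
  shows "integrable (lebesgue_on I1) f"
  by (rule finite_measure.integrable_const_bound[OF finite_measure_I1 _ assms(1), of C]) (auto simp: assms(2))

lemma borel_measurable_I1_continuous:
  fixes f :: "real \<Rightarrow> 'b::topological_space"
  assumes "continuous_on I1 f"
  shows "f \<in> borel_measurable (lebesgue_on I1)"
  using assms by (auto intro: continuous_imp_measurable_on_sets_lebesgue)

lemma continuous_on_I1_bounded:
  fixes v :: "real \<Rightarrow> real"
  assumes "continuous_on {-1..1} v"
  obtains C where "C > 0" "\<And>x. x \<in> {-1..1} \<Longrightarrow> \<bar>v x\<bar> \<le> C"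
proof -
  have "bounded (v ` {-1..1})"
    using assms by (intro compact_imp_bounded compact_continuous_image) auto
  then show ?thesis
    using that unfolding bounded_pos ball_simps real_norm_def by blast
qed

lemma L2_imp_integrable:
  assumes "h \<in> L2_space I1"
  shows "integrable (lebesgue_on I1) h"
proof (rule Bochner_Integration.integrable_bound)
  show "integrable (lebesgue_on I1) (\<lambda>x. 1 + (h x)\<^sup>2)"
    using assms finite_measure.integrable_const[OF finite_measure_I1]
    by (intro Bochner_Integration.integrable_add) (auto simp: L2_space_def)
  have "\<bar>y\<bar> \<le> 1 + y\<^sup>2" for y :: real
    using zero_le_power2[of "\<bar>y\<bar> - 1"] abs_ge_zero[of y] unfolding power2_diff by simp
  then show "AE x in lebesgue_on I1. norm (h x) \<le> norm (1 + (h x)\<^sup>2)"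
    by (auto simp: abs_of_nonneg)
qed (use assms in \<open>auto simp: L2_space_def\<close>)

lemma integrable_mult_bounded_I1:
  fixes h :: "real \<Rightarrow> real" and f :: "real \<Rightarrow> real"
  assumes "integrable (lebesgue_on I1) h" "f \<in> borel_measurable (lebesgue_on I1)"
    and "\<And>x. x \<in> I1 \<Longrightarrow> \<bar>f x\<bar> \<le> C"
  shows "integrable (lebesgue_on I1) (\<lambda>x. h x * f x)"
proof (rule Bochner_Integration.integrable_bound)
  show "integrable (lebesgue_on I1) (\<lambda>x. C * h x)"
    using assms by simp
  show "AE x in lebesgue_on I1. norm (h x * f x) \<le> norm (C * h x)"
  proof (intro AE_I2)
    fix x assume "x \<in> space (lebesgue_on I1)"
    then have "\<bar>f x\<bar> \<le> \<bar>C\<bar>"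
      using assms(3)[of x] by auto
    then show "norm (h x * f x) \<le> norm (C * h x)"
      by (simp add: abs_mult mult.commute mult_right_mono)
  qed
qed (use assms in auto)

text \<open>
  Away from the end points and for large \<open>m\<close>, the argument of \<open>flat\<close> is at least \<open>m d\<close> with a
  fixed \<open>d > 0\<close>, and the derivative of \<open>exp(-1/y)\<close> is at most \<open>1/y\<^sup>2\<close>; so the derivative of the
  cutoff is \<open>O(1/m)\<close>.
\<close>

lemma deriv_cutoff_tendsto_0_uniformly:
  assumes "0 \<le> \<rho>" "\<rho> < 1" "\<delta> > 0"
  shows "\<forall>\<^sub>F n in sequentially. \<forall>x. \<bar>x\<bar> \<le> \<rho> \<longrightarrow> \<bar>deriv (cutoff (real (Suc n))) x\<bar> \<le> \<delta>"
proof -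
  define d where "d = (1 - \<rho>\<^sup>2) / 2"
  have "\<rho>\<^sup>2 < 1"
    using assms by (simp add: abs_square_less_1)
  then have d: "d > 0" "\<rho>\<^sup>2 + d < 1"
    by (auto simp: d_def field_simps)
  have lim: "(\<lambda>n. 1 / real (Suc n)) \<longlonglongrightarrow> 0"
    using LIMSEQ_inverse_real_of_nat by (simp add: divide_inverse)
  have "(\<lambda>n. (1 - 1 / real (Suc n))\<^sup>2) \<longlonglongrightarrow> (1 - 0)\<^sup>2"
    by (intro tendsto_intros lim)
  then have "\<forall>\<^sub>F n in sequentially. (1 - 1 / real (Suc n))\<^sup>2 > \<rho>\<^sup>2 + d"
    using d by (intro order_tendstoD(1)) auto
  moreover have "(\<lambda>n. 2 / d\<^sup>2 * (1 / real (Suc n))) \<longlonglongrightarrow> 2 / d\<^sup>2 * 0"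
    by (intro tendsto_intros lim)
  then have "\<forall>\<^sub>F n in sequentially. 2 / d\<^sup>2 * (1 / real (Suc n)) < \<delta>"
    using assms by (intro order_tendstoD(2)) auto
  ultimately show ?thesis
  proof eventually_elim
    case (elim n)
    show ?case
    proof (intro allI impI)
      fix x :: real assume x: "\<bar>x\<bar> \<le> \<rho>"
      define m where "m = real (Suc n)"
      define y where "y = m * ((1 - 1 / m)\<^sup>2 - x\<^sup>2)"
      have m: "m > 0"
        by (simp add: m_def)
      have "x\<^sup>2 \<le> \<rho>\<^sup>2"
        using x assms by (metis abs_ge_zero power2_abs power_mono)
      then have "m * d \<le> y"
        using elim m unfolding y_def m_def by (intro mult_left_mono) auto
      then have "(m * d)\<^sup>2 \<le> y\<^sup>2"
        using m d by (intro power_mono) auto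
      then have "flat [:0, 0, 1:] y \<le> 1 / (m * d)\<^sup>2"
        using m d by (intro order_trans[OF flat_le] divide_left_mono mult_pos_pos)
          (auto simp: power2_eq_square intro: order_less_le_trans[rotated])
      moreover have "\<bar>x\<bar> \<le> 1"
        using x assms by simp
      ultimately have "\<bar>x\<bar> * flat [:0, 0, 1:] y \<le> 1 * (1 / (m * d)\<^sup>2)"
        using flat_nonneg by (intro mult_mono) auto
      then have "2 * m * (\<bar>x\<bar> * flat [:0, 0, 1:] y) \<le> 2 * m * (1 / (m * d)\<^sup>2)"
        using m by (intro mult_left_mono) auto
      also have "\<dots> = 2 / d\<^sup>2 * (1 / m)"
        using m d by (simp add: power2_eq_square field_simps)
      also have "\<dots> \<le> \<delta>"
        using elim by (simp add: m_def)
      finally have "2 * m * (\<bar>x\<bar> * flat [:0, 0, 1:] y) \<le> \<delta>" .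
      moreover have "\<bar>deriv (cutoff m) x\<bar> = 2 * m * (\<bar>x\<bar> * flat [:0, 0, 1:] y)"
        using m flat_nonneg[of y] by (simp add: deriv_cutoff abs_mult y_def[symmetric])
      ultimately show "\<bar>deriv (cutoff (real (Suc n))) x\<bar> \<le> \<delta>"
        by (simp only: m_def)
    qed
  qed
qed

text \<open>
  The only place where the vanishing boundary values matter: close to the end points \<open>w\<close> is small and
  the cutoff has bounded variation, elsewhere the derivative of the cutoff is uniformly small.
\<close>

lemma integral_mult_deriv_cutoff_tendsto_0:
  assumes w: "continuous_on {-1..1} w" "w (-1) = 0" "w 1 = 0"
  shows "(\<lambda>n. \<integral>x. w x * deriv (cutoff (real (Suc n))) x \<partial>lebesgue_on I1) \<longlonglongrightarrow> 0"
proof (rule tendstoI)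
  let ?d = "\<lambda>n. deriv (cutoff (real (Suc n)))"
  fix e :: real assume "e > 0"
  define \<epsilon> where "\<epsilon> = e / 4"
  have \<epsilon>: "\<epsilon> > 0"
    using \<open>e > 0\<close> by (simp add: \<epsilon>_def)
  obtain C where C: "C > 0" "\<And>x. x \<in> {-1..1} \<Longrightarrow> \<bar>w x\<bar> \<le> C"
    using continuous_on_I1_bounded[OF w(1)] by blast
  obtain r where r: "r > 0" "\<And>x. x \<in> {-1..1} \<Longrightarrow> \<bar>x - (-1)\<bar> < r \<Longrightarrow> \<bar>w x\<bar> < \<epsilon>"
    using bspec[OF w(1)[unfolded continuous_on_iff dist_real_def], of "-1"] \<epsilon> w(2) by auto
  obtain r' where r': "r' > 0" "\<And>x. x \<in> {-1..1} \<Longrightarrow> \<bar>x - 1\<bar> < r' \<Longrightarrow> \<bar>w x\<bar> < \<epsilon>"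
    using bspec[OF w(1)[unfolded continuous_on_iff dist_real_def], of 1] \<epsilon> w(3) by auto
  \<comment> \<open>If \<open>\<bar>x\<bar> > \<rho>\<close>, then \<open>x\<close> is closer than \<open>r\<close> or \<open>r'\<close> to one of the end points.\<close>
  define \<rho> where "\<rho> = max 0 (1 - min r r' / 2)"
  have \<rho>: "0 \<le> \<rho>" "\<rho> < 1"
    using r(1) r'(1) by (auto simp: \<rho>_def)
  have near: "\<bar>w x\<bar> \<le> \<epsilon>" if "x \<in> I1" "\<bar>x\<bar> > \<rho>" for x
  proof (cases "x > 0")
    case True
    then show ?thesis
      using r'(2)[of x] r'(1) r(1) that by (auto simp: \<rho>_def min_def split: if_splits)
  next
    case False
    then show ?thesis
      using r(2)[of x] r(1) r'(1) that by (auto simp: \<rho>_def min_def split: if_splits)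
  qed
  have "\<forall>\<^sub>F n in sequentially. \<forall>x. \<bar>x\<bar> \<le> \<rho> \<longrightarrow> \<bar>?d n x\<bar> \<le> \<epsilon> / (2 * C)"
    using \<rho> \<epsilon> C by (intro deriv_cutoff_tendsto_0_uniformly) auto
  then show "\<forall>\<^sub>F n in sequentially. dist (\<integral>x. w x * ?d n x \<partial>lebesgue_on I1) 0 < e"
  proof eventually_elim
    case (elim n)
    have cont: "continuous_on A (?d n)" for A
      by (intro smooth_imp_continuous_deriv smooth_cutoff)
    obtain D where D: "\<And>x. x \<in> {-1..1} \<Longrightarrow> \<bar>?d n x\<bar> \<le> D"
      using continuous_on_I1_bounded[OF cont] by blast
    have int_d: "integrable (lebesgue_on I1) (\<lambda>x. \<bar>?d n x\<bar>)"
      by (intro integrable_bounded_I1[of _ D] borel_measurable_I1_continuous continuous_intros cont)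
        (use D in auto)
    have "(\<integral>x. \<bar>?d n x\<bar> \<partial>lebesgue_on I1) = integral I1 (\<lambda>x. \<bar>?d n x\<bar>)"
      by (intro lebesgue_integral_eq_integral int_d) auto
    also have "\<dots> \<le> 2"
      using integral_abs_deriv_cutoff[of "real (Suc n)"] by (simp add: integral_open_interval_real)
    finally have d2: "(\<integral>x. \<bar>?d n x\<bar> \<partial>lebesgue_on I1) \<le> 2" .
    have pt: "\<bar>w x * ?d n x\<bar> \<le> \<epsilon> * \<bar>?d n x\<bar> + \<epsilon> / 2" if "x \<in> I1" for x
    proof (cases "\<bar>x\<bar> \<le> \<rho>")
      case True
      then have "\<bar>w x\<bar> * \<bar>?d n x\<bar> \<le> C * (\<epsilon> / (2 * C))"
        using that C elim \<epsilon> by (intro mult_mono) auto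
      then have "\<bar>w x * ?d n x\<bar> \<le> \<epsilon> / 2"
        using C(1) by (simp add: abs_mult)
      moreover have "0 \<le> \<epsilon> * \<bar>?d n x\<bar>"
        using \<epsilon> by simp
      ultimately show ?thesis
        by linarith
    next
      case False
      then have "\<bar>w x\<bar> * \<bar>?d n x\<bar> \<le> \<epsilon> * \<bar>?d n x\<bar>"
        using that near[of x] by (intro mult_right_mono) auto
      then show ?thesis
        using \<epsilon> by (simp add: abs_mult)
    qed
    have "\<bar>\<integral>x. w x * ?d n x \<partial>lebesgue_on I1\<bar> \<le> (\<integral>x. \<bar>w x * ?d n x\<bar> \<partial>lebesgue_on I1)"
      by (rule integral_abs_bound)
    also have "\<dots> \<le> (\<integral>x. \<epsilon> * \<bar>?d n x\<bar> + \<epsilon> / 2 \<partial>lebesgue_on I1)"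
      using int_d pt \<epsilon> finite_measure.integrable_const[OF finite_measure_I1]
      by (intro integral_mono' Bochner_Integration.integrable_add) auto
    also have "\<dots> = \<epsilon> * (\<integral>x. \<bar>?d n x\<bar> \<partial>lebesgue_on I1) + \<epsilon>"
      using int_d finite_measure.integrable_const[OF finite_measure_I1] measure_I1
      by (subst Bochner_Integration.integral_add) auto
    also have "\<dots> \<le> \<epsilon> * 2 + \<epsilon>"
      using d2 \<epsilon> by (intro add_mono mult_left_mono) auto
    also have "\<dots> < e"
      using \<epsilon> by (simp add: \<epsilon>_def)
    finally show ?case
      by simp
  qed
qed

text \<open>
  For a function in \<open>H\<^sub>0\<^sup>1\<close> the integration by parts formula extends from test functions to all
  smooth \<open>\<phi>\<close>: apply it to \<open>cutoff m \<cdot> \<phi>\<close> and let \<open>m\<close> tend to infinity.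
\<close>

lemma weak_deriv_smooth:
  assumes weak: "has_L2_weak_deriv I1 f g"
    and u: "continuous_on {-1..1} u" "u (-1) = 0" "u 1 = 0" "AE x in lebesgue_on I1. f x = u x"
    and \<phi>: "smooth \<phi>"
  shows "(\<integral>x. f x * deriv \<phi> x \<partial>lebesgue_on I1) = - (\<integral>x. g x * \<phi> x \<partial>lebesgue_on I1)"
proof -
  let ?N = "lebesgue_on I1"
  let ?c = "\<lambda>n. cutoff (real (Suc n))"
  have cont_c: "continuous_on A (?c n)" and cont_\<phi>: "continuous_on A \<phi>" for A n
    using smooth_DERIV[OF \<phi>] smooth_DERIV[OF smooth_cutoff]
    by (meson DERIV_isCont continuous_at_imp_continuous_on)+
  have cont_d: "continuous_on A (deriv (?c n))" "continuous_on A (deriv \<phi>)" for A n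
    by (intro smooth_imp_continuous_deriv smooth_cutoff \<phi>)+
  note meas = borel_measurable_I1_continuous
  have fi: "integrable ?N f" and gi: "integrable ?N g"
    using weak L2_imp_integrable by (auto simp: has_L2_weak_deriv_def)
  have intg: "integrable ?N (\<lambda>x. h x * v x)"
    if h: "integrable ?N h" and v: "\<And>A. continuous_on A v" for h v :: "real \<Rightarrow> real"
  proof -
    obtain C where "\<And>x. x \<in> {-1..1} \<Longrightarrow> \<bar>v x\<bar> \<le> C"
      using continuous_on_I1_bounded[OF v] by blast
    then show ?thesis
      by (intro integrable_mult_bounded_I1[OF h meas[OF v], of C]) auto
  qed
  have lim: "(\<lambda>n. \<integral>x. h x * (?c n x * v x) \<partial>?N) \<longlonglongrightarrow> (\<integral>x. h x * v x \<partial>?N)"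
    if "integrable ?N h" "\<And>A. continuous_on A v" for h v :: "real \<Rightarrow> real"
  proof (rule integral_dominated_convergence)
    show "integrable ?N (\<lambda>x. \<bar>h x * v x\<bar>)"
      using intg[OF that] by simp
    show "AE x in ?N. (\<lambda>n. h x * (?c n x * v x)) \<longlonglongrightarrow> h x * v x"
    proof (intro AE_I2)
      fix x assume "x \<in> space ?N"
      then have "(\<lambda>n. h x * (?c n x * v x)) \<longlonglongrightarrow> h x * (1 * v x)"
        by (intro tendsto_intros cutoff_tendsto_1) auto
      then show "(\<lambda>n. h x * (?c n x * v x)) \<longlonglongrightarrow> h x * v x"
        by simp
    qed
    show "AE x in ?N. norm (h x * (?c n x * v x)) \<le> \<bar>h x * v x\<bar>" for n
    proof (intro AE_I2)
      fix x
      have "\<bar>h x * v x\<bar> * \<bar>?c n x\<bar> \<le> \<bar>h x * v x\<bar> * 1"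
        using cutoff_nonneg cutoff_le_1 by (intro mult_left_mono) auto
      then show "norm (h x * (?c n x * v x)) \<le> \<bar>h x * v x\<bar>"
        by (simp add: abs_mult mult_ac)
    qed
    show "(\<lambda>x. h x * v x) \<in> borel_measurable ?N"
      using intg[OF that] by simp
    show "(\<lambda>x. h x * (?c n x * v x)) \<in> borel_measurable ?N" for n
      by (rule borel_measurable_times[OF borel_measurable_integrable[OF that(1)]
            meas[OF continuous_on_mult[OF cont_c that(2)]]])
  qed
  have eq: "(\<integral>x. f x * (?c n x * deriv \<phi> x) \<partial>?N) + (\<integral>x. u x * \<phi> x * deriv (?c n) x \<partial>?N)
      = - (\<integral>x. g x * (?c n x * \<phi> x) \<partial>?N)" for n
  proof -
    have "deriv (\<lambda>x. ?c n x * \<phi> x) x = ?c n x * deriv \<phi> x + \<phi> x * deriv (?c n) x" for x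
      using DERIV_mult[OF smooth_DERIV[OF smooth_cutoff] smooth_DERIV[OF \<phi>]]
      by (intro DERIV_imp_deriv) (simp add: mult.commute add.commute)
    moreover have "(\<integral>x. f x * deriv (\<lambda>x. ?c n x * \<phi> x) x \<partial>?N) = - (\<integral>x. g x * (?c n x * \<phi> x) \<partial>?N)"
      using weak test_function_cutoff_mult[of "real (Suc n)", OF _ \<phi>]
      by (auto simp: has_L2_weak_deriv_def)
    ultimately have "(\<integral>x. f x * (?c n x * deriv \<phi> x) + f x * (\<phi> x * deriv (?c n) x) \<partial>?N)
        = - (\<integral>x. g x * (?c n x * \<phi> x) \<partial>?N)"
      by (simp add: distrib_left)
    moreover have "(\<integral>x. f x * (?c n x * deriv \<phi> x) + f x * (\<phi> x * deriv (?c n) x) \<partial>?N)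
      = (\<integral>x. f x * (?c n x * deriv \<phi> x) \<partial>?N) + (\<integral>x. f x * (\<phi> x * deriv (?c n) x) \<partial>?N)"
      by (intro Bochner_Integration.integral_add intg fi continuous_on_mult cont_c cont_d cont_\<phi>)
    moreover have "(\<integral>x. f x * (\<phi> x * deriv (?c n) x) \<partial>?N) = (\<integral>x. u x * \<phi> x * deriv (?c n) x \<partial>?N)"
    proof (rule integral_cong_AE)
      show "(\<lambda>x. f x * (\<phi> x * deriv (?c n) x)) \<in> borel_measurable ?N"
        by (rule borel_measurable_times[OF borel_measurable_integrable[OF fi]
              meas[OF continuous_on_mult[OF cont_\<phi> cont_d(1)]]])
      show "(\<lambda>x. u x * \<phi> x * deriv (?c n) x) \<in> borel_measurable ?N"
        by (intro meas continuous_on_mult cont_\<phi> cont_d continuous_on_subset[OF u(1)]) auto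
      show "AE x in ?N. f x * (\<phi> x * deriv (?c n) x) = u x * \<phi> x * deriv (?c n) x"
        using u(4) by eventually_elim simp
    qed
    ultimately show ?thesis
      by simp
  qed
  have "(\<lambda>n. (\<integral>x. f x * (?c n x * deriv \<phi> x) \<partial>?N) + (\<integral>x. u x * \<phi> x * deriv (?c n) x \<partial>?N))
      \<longlonglongrightarrow> (\<integral>x. f x * deriv \<phi> x \<partial>?N) + 0"
    using u by (intro tendsto_add lim fi cont_d integral_mult_deriv_cutoff_tendsto_0 continuous_on_mult cont_\<phi>) auto
  moreover have "(\<lambda>n. - (\<integral>x. g x * (?c n x * \<phi> x) \<partial>?N)) \<longlonglongrightarrow> - (\<integral>x. g x * \<phi> x \<partial>?N)"
    by (intro tendsto_minus lim gi cont_\<phi>)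
  ultimately show ?thesis
    unfolding eq by (auto dest: LIMSEQ_unique)
qed

section \<open>The Fourier transform and the weak derivative\<close>

lemma fourier_eq_cos_sin:
  assumes "integrable (lebesgue_on I1) h"
  shows "fourier h \<xi> = of_real (1 / sqrt (2 * pi)) *
    (of_real (\<integral>x. h x * cos (\<xi> * x) \<partial>lebesgue_on I1) - \<i> * of_real (\<integral>x. h x * sin (\<xi> * x) \<partial>lebesgue_on I1))"
proof -
  let ?N = "lebesgue_on I1"
  have i: "integrable ?N (\<lambda>x. h x * cos (\<xi> * x))" "integrable ?N (\<lambda>x. h x * sin (\<xi> * x))"
    by (intro integrable_mult_bounded_I1[OF assms, of _ 1] borel_measurable_I1_continuous continuous_intros; simp)+
  have "exp (- \<i> * complex_of_real (x * \<xi>)) = of_real (cos (\<xi> * x)) - \<i> * of_real (sin (\<xi> * x))" for x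
    by (simp add: exp_eq_polar complex_eq_iff Re_exp Im_exp mult.commute)
  then have "(\<integral>x. complex_of_real (h x) * exp (- \<i> * complex_of_real (x * \<xi>)) \<partial>?N)
    = (\<integral>x. complex_of_real (h x * cos (\<xi> * x)) - \<i> * complex_of_real (h x * sin (\<xi> * x)) \<partial>?N)"
    by (simp only: right_diff_distrib of_real_mult mult.left_commute)
  also have "\<dots> = of_real (\<integral>x. h x * cos (\<xi> * x) \<partial>?N) - \<i> * of_real (\<integral>x. h x * sin (\<xi> * x) \<partial>?N)"
    using i by (subst Bochner_Integration.integral_diff) (auto simp del: of_real_mult)
  finally show ?thesis
    by (simp add: fourier_def)
qed

lemma fourier_weak_deriv:
  assumes weak: "has_L2_weak_deriv I1 f g"
    and u: "continuous_on {-1..1} u" "u (-1) = 0" "u 1 = 0" "AE x in lebesgue_on I1. f x = u x"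
  shows "fourier g \<xi> = \<i> * of_real \<xi> * fourier f \<xi>"
proof -
  let ?N = "lebesgue_on I1"
  have i: "integrable ?N f" "integrable ?N g"
    using weak L2_imp_integrable by (auto simp: has_L2_weak_deriv_def)
  have s: "smooth (\<lambda>x. cos (\<xi> * x))" "smooth (\<lambda>x. sin (\<xi> * x))"
    by (intro smooth_compose[OF smooth_cos] smooth_compose[OF smooth_sin] smooth_mult smooth_const smooth_ident)+
  have d: "deriv (\<lambda>x. cos (\<xi> * x)) x = - (\<xi> * sin (\<xi> * x))" "deriv (\<lambda>x. sin (\<xi> * x)) x = \<xi> * cos (\<xi> * x)" for x
    by (auto intro!: DERIV_imp_deriv derivative_eq_intros)
  have "(\<integral>x. g x * cos (\<xi> * x) \<partial>?N) = - (\<integral>x. f x * - (\<xi> * sin (\<xi> * x)) \<partial>?N)"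
    using weak_deriv_smooth[OF assms s(1)] by (simp add: d)
  also have "\<dots> = \<xi> * (\<integral>x. f x * sin (\<xi> * x) \<partial>?N)"
    by (simp add: mult.left_commute)
  finally have c: "(\<integral>x. g x * cos (\<xi> * x) \<partial>?N) = \<xi> * (\<integral>x. f x * sin (\<xi> * x) \<partial>?N)" .
  have "(\<integral>x. g x * sin (\<xi> * x) \<partial>?N) = - (\<integral>x. f x * (\<xi> * cos (\<xi> * x)) \<partial>?N)"
    using weak_deriv_smooth[OF assms s(2)] by (simp add: d)
  also have "\<dots> = - \<xi> * (\<integral>x. f x * cos (\<xi> * x) \<partial>?N)"
    by (simp add: mult.left_commute)
  finally have s: "(\<integral>x. g x * sin (\<xi> * x) \<partial>?N) = - \<xi> * (\<integral>x. f x * cos (\<xi> * x) \<partial>?N)" .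
  show ?thesis
    unfolding fourier_eq_cos_sin[OF i(1)] fourier_eq_cos_sin[OF i(2)] c s
    by (simp add: complex_eq_iff)
qed

section \<open>Gaussian means of the squared Fourier transform\<close>

abbreviation (input) "phase x \<xi> \<equiv> exp (- \<i> * complex_of_real (x * \<xi>))"

lemma norm_phase: "norm (exp (- \<i> * complex_of_real t)) = 1"
  using norm_exp_i_times[of "-t"] by simp

lemma sigma_finite_I1: "sigma_finite_measure (lebesgue_on I1)"
  by (rule finite_measure.sigma_finite_measure[OF finite_measure_I1])

lemma Fubini_finite_measure:
  fixes K :: "'a \<Rightarrow> 'b \<Rightarrow> 'c::{banach, second_countable_topology}"
  assumes M: "finite_measure M" and N: "finite_measure N"
    and K: "case_prod K \<in> borel_measurable (M \<Otimes>\<^sub>M N)"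
    and k: "integrable N k" "\<And>s x. norm (K s x) \<le> k x"
  shows "(\<integral>s. (\<integral>x. K s x \<partial>N) \<partial>M) = (\<integral>x. (\<integral>s. K s x \<partial>M) \<partial>N)"
    and "integrable M (\<lambda>s. \<integral>x. K s x \<partial>N)" and "integrable N (\<lambda>x. \<integral>s. K s x \<partial>M)"
proof -
  interpret M: finite_measure M by (rule M)
  interpret N: finite_measure N by (rule N)
  interpret pair_sigma_finite M N ..
  have [measurable]: "k \<in> borel_measurable N"
    using k(1) by simp
  have "integrable (M \<Otimes>\<^sub>M N) (\<lambda>(s, x). k x)"
    by (rule Fubini_integrable) (use k(1) in auto)
  then have int: "integrable (M \<Otimes>\<^sub>M N) (case_prod K)"
    using K by (rule Bochner_Integration.integrable_bound)
      (auto intro!: AE_I2 intro: order_trans[OF k(2)])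
  show "(\<integral>s. (\<integral>x. K s x \<partial>N) \<partial>M) = (\<integral>x. (\<integral>s. K s x \<partial>M) \<partial>N)"
    using Fubini_integral[OF int] by simp
  show "integrable M (\<lambda>s. \<integral>x. K s x \<partial>N)"
    using integrable_fst[OF int] .
  show "integrable N (\<lambda>x. \<integral>s. K s x \<partial>M)"
    using integrable_snd[OF int] .
qed

lemma measurable_id_I1: "(\<lambda>x. x) \<in> borel_measurable (lebesgue_on I1)"
  by (intro borel_measurable_I1_continuous continuous_intros)

lemma borel_measurable_fourier:
  assumes "h \<in> borel_measurable (lebesgue_on I1)"
  shows "fourier h \<in> borel_measurable borel"
proof -
  interpret sigma_finite_measure "lebesgue_on I1"
    by (rule sigma_finite_I1)
  note [measurable] = assms measurable_compose[OF measurable_snd measurable_id_I1]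
  show ?thesis
    unfolding fourier_def[abs_def] by measurable
qed

lemma norm_fourier_le:
  "norm (fourier h \<xi>) \<le> 1 / sqrt (2 * pi) * (\<integral>x. \<bar>h x\<bar> \<partial>lebesgue_on I1)"
proof -
  have "norm (\<integral>x. complex_of_real (h x) * phase x \<xi> \<partial>lebesgue_on I1)
      \<le> (\<integral>x. norm (complex_of_real (h x) * phase x \<xi>) \<partial>lebesgue_on I1)"
    by (rule integral_norm_bound)
  also have "\<dots> = (\<integral>x. \<bar>h x\<bar> \<partial>lebesgue_on I1)"
    by (simp only: norm_mult norm_phase norm_of_real mult_1_right)
  finally show ?thesis
    unfolding fourier_def norm_mult norm_of_real
    by (intro mult_mono) auto
qed

interpretation std_normal: prob_space std_normal_distribution
  by (rule prob_space_normal_density) simp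

lemma integral_std_normal_phase:
  "(\<integral>s. exp (- \<i> * complex_of_real (t * s)) \<partial>std_normal_distribution) = of_real (exp (- t\<^sup>2 / 2))"
  using fun_cong[OF char_std_normal_distribution, of "-t"] by (simp add: char_def)

text \<open>
  Expand \<open>|\<close>\<open>fourier h\<close>\<open>|\<^sup>2\<close> as a double integral and interchange it with the Gaussian mean; the inner
  mean of the phases is the characteristic function of the normal distribution.
\<close>

lemma gaussian_mean_norm_fourier:
  assumes h: "integrable (lebesgue_on I1) h"
  shows "(\<integral>s. (norm (fourier h (n * s)))\<^sup>2 \<partial>std_normal_distribution) =
    1 / (2 * pi) * (\<integral>x. (\<integral>y. h x * h y * exp (- (n * (x - y))\<^sup>2 / 2) \<partial>lebesgue_on I1) \<partial>lebesgue_on I1)"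
proof -
  let ?N = "lebesgue_on I1" and ?M = std_normal_distribution
  let ?H = "\<integral>x. \<bar>h x\<bar> \<partial>?N"
  interpret N: finite_measure ?N by (rule finite_measure_I1)
  define K where "K x s y = complex_of_real (h x * h y) * phase (x - y) (n * s)" for x s y
  have [measurable]: "h \<in> borel_measurable ?N"
    using h by simp
  have [measurable]: "(\<lambda>x. x) \<in> borel_measurable ?N"
    by (rule measurable_id_I1)
  have [measurable]: "snd \<in> borel_measurable (M \<Otimes>\<^sub>M ?N)" for M :: "'m measure"
    using measurable_compose[OF measurable_snd measurable_id_I1] .
  have [measurable]: "(\<lambda>p. snd (fst p)) \<in> borel_measurable ((M \<Otimes>\<^sub>M ?N) \<Otimes>\<^sub>M L)" for M :: "'m measure" and L :: "'l measure"
    using measurable_compose[OF measurable_fst, OF measurable_compose[OF measurable_snd measurable_id_I1]] .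
  have norm_K: "norm (K x s y) = \<bar>h x\<bar> * \<bar>h y\<bar>" for x s y
    unfolding K_def norm_mult norm_phase norm_of_real abs_mult by simp
  have norm_int_K: "norm (\<integral>y. K x s y \<partial>?N) \<le> \<bar>h x\<bar> * ?H" for x s
    using integral_norm_bound[of ?N "K x s"] by (simp add: norm_K)
  have sq: "complex_of_real ((norm (fourier h (n * s)))\<^sup>2) =
      of_real (1 / (2 * pi)) * (\<integral>x. (\<integral>y. K x s y \<partial>?N) \<partial>?N)" for s
  proof -
    let ?J = "\<integral>x. complex_of_real (h x) * phase x (n * s) \<partial>?N"
    have "K x s y = (complex_of_real (h x) * phase x (n * s)) * cnj (complex_of_real (h y) * phase y (n * s))" for x y
      by (simp add: K_def exp_cnj algebra_simps flip: exp_add)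
    then have "(\<integral>y. K x s y \<partial>?N) = (complex_of_real (h x) * phase x (n * s)) * cnj ?J" for x
      by (simp only: integral_mult_right_zero Bochner_Integration.integral_cnj)
    then have "(\<integral>x. (\<integral>y. K x s y \<partial>?N) \<partial>?N) = ?J * cnj ?J"
      by (simp only: integral_mult_left_zero)
    moreover have "complex_of_real ((norm (fourier h (n * s)))\<^sup>2) =
        of_real (1 / sqrt (2 * pi)) * of_real (1 / sqrt (2 * pi)) * (?J * cnj ?J)"
      unfolding complex_norm_square fourier_def by simp
    moreover have "complex_of_real (1 / sqrt (2 * pi)) * of_real (1 / sqrt (2 * pi)) = of_real (1 / (2 * pi))"
      unfolding of_real_mult[symmetric] by (simp add: real_sqrt_mult[symmetric])
    ultimately show ?thesis
      by simp
  qed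
  have "complex_of_real (\<integral>s. (norm (fourier h (n * s)))\<^sup>2 \<partial>?M) =
      (\<integral>s. complex_of_real ((norm (fourier h (n * s)))\<^sup>2) \<partial>?M)"
    by (rule integral_complex_of_real[symmetric])
  also have "\<dots> = of_real (1 / (2 * pi)) * (\<integral>s. (\<integral>x. (\<integral>y. K x s y \<partial>?N) \<partial>?N) \<partial>?M)"
    unfolding sq by (rule integral_mult_right_zero)
  also have "(\<integral>s. (\<integral>x. (\<integral>y. K x s y \<partial>?N) \<partial>?N) \<partial>?M) = (\<integral>x. (\<integral>s. (\<integral>y. K x s y \<partial>?N) \<partial>?M) \<partial>?N)"
  proof (rule Fubini_finite_measure(1))
    show "finite_measure ?M" by (rule std_normal.finite_measure_axioms)
    show "finite_measure ?N" by (rule finite_measure_I1)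
    show "(\<lambda>(s, x). \<integral>y. K x s y \<partial>?N) \<in> borel_measurable (?M \<Otimes>\<^sub>M ?N)"
      unfolding K_def by measurable
    show "integrable ?N (\<lambda>x. \<bar>h x\<bar> * ?H)"
      using h by simp
  qed (rule norm_int_K)
  also have "\<dots> = (\<integral>x. (\<integral>y. (\<integral>s. K x s y \<partial>?M) \<partial>?N) \<partial>?N)"
  proof -
    have "(\<integral>s. (\<integral>y. K x s y \<partial>?N) \<partial>?M) = (\<integral>y. (\<integral>s. K x s y \<partial>?M) \<partial>?N)" for x
    proof (rule Fubini_finite_measure(1))
      show "finite_measure ?M" by (rule std_normal.finite_measure_axioms)
      show "finite_measure ?N" by (rule finite_measure_I1)
      show "(\<lambda>(s, y). K x s y) \<in> borel_measurable (?M \<Otimes>\<^sub>M ?N)"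
        unfolding K_def by measurable
      show "integrable ?N (\<lambda>y. \<bar>h x\<bar> * \<bar>h y\<bar>)"
        using h by simp
    qed (simp add: norm_K)
    then show ?thesis
      by simp
  qed
  also have "\<dots> = (\<integral>x. (\<integral>y. complex_of_real (h x * h y * exp (- (n * (x - y))\<^sup>2 / 2)) \<partial>?N) \<partial>?N)"
  proof -
    have "(\<integral>s. K x s y \<partial>?M) = complex_of_real (h x * h y * exp (- (n * (x - y))\<^sup>2 / 2))" for x y
      using integral_std_normal_phase[of "n * (x - y)"]
      unfolding K_def by (simp add: algebra_simps)
    then show ?thesis
      by simp
  qed
  also have "\<dots> = of_real (\<integral>x. (\<integral>y. h x * h y * exp (- (n * (x - y))\<^sup>2 / 2) \<partial>?N) \<partial>?N)"
    by (simp only: integral_complex_of_real)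
  finally show ?thesis
    unfolding of_real_mult[symmetric] of_real_eq_iff .
qed

text \<open>
  The density of the centred normal distribution with standard deviation \<open>1/n\<close>.
\<close>

definition gauss_kernel :: "real \<Rightarrow> real \<Rightarrow> real" where
  "gauss_kernel n z = n * std_normal_density (n * z)"

text \<open>
  By the substitution \<open>\<xi> = n s\<close> this is the integral of \<open>exp(-\<xi>\<^sup>2/(2 n\<^sup>2)) |\<close>\<open>fourier h \<xi>\<close>\<open>|\<^sup>2\<close> over
  the line. It is written as a mean over the standard normal distribution, whose characteristic
  function then yields the kernel.
\<close>

definition gauss_energy :: "real \<Rightarrow> (real \<Rightarrow> real) \<Rightarrow> real" where
  "gauss_energy n h = n * sqrt (2 * pi) *
     (\<integral>s. (norm (fourier h (n * s)))\<^sup>2 \<partial>std_normal_distribution)"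

lemma gauss_energy_eq:
  assumes h: "integrable (lebesgue_on I1) h"
  shows "gauss_energy n h =
    (\<integral>x. (\<integral>y. h x * h y * gauss_kernel n (x - y) \<partial>lebesgue_on I1) \<partial>lebesgue_on I1)"
proof -
  have "n * sqrt (2 * pi) * (1 / (2 * pi)) = n * (1 / sqrt (2 * pi))"
    by (simp add: field_simps)
  then have "h x * h y * gauss_kernel n (x - y) =
     n * sqrt (2 * pi) * (1 / (2 * pi)) * (h x * h y * exp (- (n * (x - y))\<^sup>2 / 2))" for x y
    by (simp add: gauss_kernel_def std_normal_density_def)
  then show ?thesis
    by (simp add: gauss_energy_def gaussian_mean_norm_fourier[OF h])
qed

lemma gauss_kernel_nonneg: "n \<ge> 0 \<Longrightarrow> 0 \<le> gauss_kernel n z"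
  by (simp add: gauss_kernel_def)

lemma gauss_kernel_le: "n \<ge> 0 \<Longrightarrow> gauss_kernel n z \<le> n"
proof -
  have "std_normal_density t \<le> 1" for t
  proof -
    have "(1 / sqrt (2 * pi)) * exp (- t\<^sup>2 / 2) \<le> 1 * 1"
      using pi_ge_two by (intro mult_mono) auto
    then show ?thesis
      by (simp add: std_normal_density_def)
  qed
  then show "n \<ge> 0 \<Longrightarrow> gauss_kernel n z \<le> n"
    using mult_left_le by (simp add: gauss_kernel_def mult_left_le)
qed

lemma gauss_kernel_commute: "gauss_kernel n (x - y) = gauss_kernel n (y - x)"
  by (simp add: gauss_kernel_def std_normal_density_def power2_eq_square algebra_simps)

lemma continuous_gauss_kernel: "continuous_on A (gauss_kernel n)"
  unfolding gauss_kernel_def[abs_def] std_normal_density_def by (intro continuous_intros) auto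

lemma measurable_gauss_kernel [measurable]: "gauss_kernel n \<in> borel_measurable borel"
  by (intro borel_measurable_continuous_onI continuous_gauss_kernel)

lemma integral_I1_eq_lborel:
  fixes v :: "real \<Rightarrow> real"
  assumes "(\<lambda>y. indicator I1 y * v y) \<in> borel_measurable borel"
  shows "(\<integral>y. v y \<partial>lebesgue_on I1) = (\<integral>y. indicator I1 y * v y \<partial>lborel)"
  using assms by (simp add: integral_restrict_space integral_completion)

lemma integral_gauss_kernel:
  assumes n: "n > 0" and v: "(\<lambda>y. indicator I1 y * v y) \<in> borel_measurable borel"
  shows "(\<integral>y. v y * gauss_kernel n (x - y) \<partial>lebesgue_on I1) =
    (\<integral>s. indicator I1 (x - s / n) * v (x - s / n) * std_normal_density s \<partial>lborel)"
proof -
  have "(\<integral>y. v y * gauss_kernel n (x - y) \<partial>lebesgue_on I1) =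
      (\<integral>y. indicator I1 y * v y * gauss_kernel n (x - y) \<partial>lborel)"
    using v by (subst integral_I1_eq_lborel) (auto simp: mult.assoc[symmetric])
  also have "\<dots> = (\<integral>s. indicator I1 (x - s / n) * v (x - s / n) * std_normal_density s \<partial>lborel)"
    using n by (subst lborel_integral_real_affine[where c="- (1 / n)" and t=x])
      (auto simp: gauss_kernel_def integral_mult_right_zero[symmetric] simp del: integral_mult_right_zero integral_mult_left_zero integral_mult_right integral_divide
        intro!: Bochner_Integration.integral_cong)
  finally show ?thesis .
qed

lemma integral_gauss_kernel_le_1:
  assumes "n > 0"
  shows "(\<integral>y. gauss_kernel n (x - y) \<partial>lebesgue_on I1) \<le> 1"
proof -
  have "(\<integral>y. gauss_kernel n (x - y) \<partial>lebesgue_on I1) =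
      (\<integral>s. indicator I1 (x - s / n) * std_normal_density s \<partial>lborel)"
    using integral_gauss_kernel[OF assms, of "\<lambda>_. 1" x] by simp
  also have "\<dots> \<le> (\<integral>s. std_normal_density s \<partial>lborel)"
    by (intro integral_mono') (auto simp: indicator_def)
  finally show ?thesis
    by simp
qed

text \<open>
  One half of the Plancherel theorem, valid for all of \<open>L\<^sup>2\<close>: bound \<open>h(x) h(y)\<close> by
  \<open>(h(x)\<^sup>2 + h(y)\<^sup>2)/2\<close> and use that the kernel is symmetric with mass at most \<open>1\<close>.
\<close>

lemma gauss_energy_le:
  assumes h: "h \<in> L2_space I1" and n: "n > 0"
  shows "gauss_energy n h \<le> (\<integral>x. (h x)\<^sup>2 \<partial>lebesgue_on I1)"
proof -
  let ?N = "lebesgue_on I1" and ?G = "\<lambda>x y. gauss_kernel n (x - y)"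
  interpret N: finite_measure ?N by (rule finite_measure_I1)
  have hi: "integrable ?N h" and h2: "integrable ?N (\<lambda>x. (h x)\<^sup>2)"
    using h L2_imp_integrable[OF h] by (auto simp: L2_space_def)
  have [measurable]: "h \<in> borel_measurable ?N"
    using hi by simp
  have [measurable]: "(\<lambda>x. x) \<in> borel_measurable ?N"
    by (rule measurable_id_I1)
  have [measurable]: "snd \<in> borel_measurable (?N \<Otimes>\<^sub>M ?N)"
    using measurable_compose[OF measurable_snd measurable_id_I1] .
  have [measurable]: "fst \<in> borel_measurable (?N \<Otimes>\<^sub>M ?N)"
    using measurable_compose[OF measurable_fst measurable_id_I1] .
  have G: "0 \<le> ?G x y" "?G x y \<le> n" for x y
    using n gauss_kernel_nonneg gauss_kernel_le by auto
  have Gi: "integrable ?N (\<lambda>y. v y * ?G x y)" if "integrable ?N v" for v :: "real \<Rightarrow> real" and x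
    using G by (intro integrable_mult_bounded_I1[OF that, of _ n]) auto
  have G1: "(\<integral>y. ?G x y \<partial>?N) \<le> 1" "0 \<le> (\<integral>y. ?G x y \<partial>?N)" for x
    using integral_gauss_kernel_le_1[OF n] G(1) by auto
  have fin: "finite_measure ?N" by (rule finite_measure_I1)
  have hh: "integrable ?N (\<lambda>x. \<integral>y. h x * h y * ?G x y \<partial>?N)"
  proof (rule Bochner_Integration.integrable_bound)
    show "integrable ?N (\<lambda>x. \<bar>h x\<bar> * (n * (\<integral>y. \<bar>h y\<bar> \<partial>?N)))"
      using hi by simp
    show "AE x in ?N. norm (\<integral>y. h x * h y * ?G x y \<partial>?N) \<le> norm (\<bar>h x\<bar> * (n * (\<integral>y. \<bar>h y\<bar> \<partial>?N)))"
    proof (intro AE_I2)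
      fix x
      have "\<bar>\<integral>y. h x * h y * ?G x y \<partial>?N\<bar> \<le> (\<integral>y. \<bar>h x * h y * ?G x y\<bar> \<partial>?N)"
        by (rule integral_abs_bound)
      also have "\<dots> \<le> (\<integral>y. \<bar>h x\<bar> * (n * \<bar>h y\<bar>) \<partial>?N)"
        using hi G n by (intro integral_mono') (auto simp: abs_mult mult.assoc mult.commute[of n] intro!: mult_left_mono)
      finally show "norm (\<integral>y. h x * h y * ?G x y \<partial>?N) \<le> norm (\<bar>h x\<bar> * (n * (\<integral>y. \<bar>h y\<bar> \<partial>?N)))"
        using n by (simp add: abs_mult)
    qed
  qed measurable
  have i1: "integrable ?N (\<lambda>x. \<integral>y. (h x)\<^sup>2 * ?G x y \<partial>?N)"
  proof (rule Bochner_Integration.integrable_bound[OF h2])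
    show "AE x in ?N. norm (\<integral>y. (h x)\<^sup>2 * ?G x y \<partial>?N) \<le> norm ((h x)\<^sup>2)"
      using G1 by (auto simp: abs_mult intro!: AE_I2 mult_left_le)
  qed measurable
  have sw: "(\<integral>x. (\<integral>y. (h y)\<^sup>2 * ?G x y \<partial>?N) \<partial>?N) = (\<integral>y. (\<integral>x. (h y)\<^sup>2 * ?G x y \<partial>?N) \<partial>?N)"
    "integrable ?N (\<lambda>x. \<integral>y. (h y)\<^sup>2 * ?G x y \<partial>?N)"
    using G n h2
    by (intro Fubini_finite_measure[OF fin fin, of _ "\<lambda>y. (h y)\<^sup>2 * n"]; auto simp: abs_mult intro!: mult_left_mono)+
  have "gauss_energy n h = (\<integral>x. (\<integral>y. h x * h y * ?G x y \<partial>?N) \<partial>?N)"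
    by (rule gauss_energy_eq[OF hi])
  also have "\<dots> \<le> (\<integral>x. ((\<integral>y. (h x)\<^sup>2 * ?G x y \<partial>?N) + (\<integral>y. (h y)\<^sup>2 * ?G x y \<partial>?N)) / 2 \<partial>?N)"
  proof (rule integral_mono[OF hh])
    show "integrable ?N (\<lambda>x. ((\<integral>y. (h x)\<^sup>2 * ?G x y \<partial>?N) + (\<integral>y. (h y)\<^sup>2 * ?G x y \<partial>?N)) / 2)"
      using i1 sw(2) by (intro integrable_divide Bochner_Integration.integrable_add)
    fix x
    have "(\<integral>y. h x * h y * ?G x y \<partial>?N) \<le> (\<integral>y. ((h x)\<^sup>2 * ?G x y + (h y)\<^sup>2 * ?G x y) / 2 \<partial>?N)"
    proof (rule integral_mono)
      show "integrable ?N (\<lambda>y. h x * h y * ?G x y)"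
        using Gi[of "\<lambda>y. h x * h y" x] hi by simp
      show "integrable ?N (\<lambda>y. ((h x)\<^sup>2 * ?G x y + (h y)\<^sup>2 * ?G x y) / 2)"
        using Gi[of "\<lambda>_. (h x)\<^sup>2" x] Gi[OF h2, of x] fin
        by (intro integrable_divide Bochner_Integration.integrable_add) auto
      fix y
      have "h x * h y \<le> ((h x)\<^sup>2 + (h y)\<^sup>2) / 2"
        using sum_squares_bound[of "h x" "h y"] by simp
      from mult_right_mono[OF this G(1)[of x y]]
      show "h x * h y * ?G x y \<le> ((h x)\<^sup>2 * ?G x y + (h y)\<^sup>2 * ?G x y) / 2"
        by (simp add: field_simps)
    qed
    also have "\<dots> = ((\<integral>y. (h x)\<^sup>2 * ?G x y \<partial>?N) + (\<integral>y. (h y)\<^sup>2 * ?G x y \<partial>?N)) / 2"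
      using Gi[of "\<lambda>_. (h x)\<^sup>2" x] Gi[OF h2, of x] by (simp del: integral_mult_right_zero integral_mult_right)
    finally show "(\<integral>y. h x * h y * ?G x y \<partial>?N) \<le> ((\<integral>y. (h x)\<^sup>2 * ?G x y \<partial>?N) + (\<integral>y. (h y)\<^sup>2 * ?G x y \<partial>?N)) / 2" .
  qed
  also have "\<dots> = ((\<integral>x. (\<integral>y. (h x)\<^sup>2 * ?G x y \<partial>?N) \<partial>?N) + (\<integral>x. (\<integral>y. (h y)\<^sup>2 * ?G x y \<partial>?N) \<partial>?N)) / 2"
    unfolding integral_divide_zero by (subst Bochner_Integration.integral_add[OF i1 sw(2)]) (rule refl)
  also have "\<dots> = (\<integral>x. (\<integral>y. (h x)\<^sup>2 * ?G x y \<partial>?N) \<partial>?N)"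
    unfolding sw(1) by (subst (2) gauss_kernel_commute) simp
  also have "\<dots> \<le> (\<integral>x. (h x)\<^sup>2 \<partial>?N)"
    using G1 by (intro integral_mono[OF i1 h2]) (auto intro!: mult_left_le)
  finally show ?thesis .
qed

text \<open>
  At interior points the restriction to the interval is harmless: after the substitution
  \<open>y = x - s/n\<close> the argument tends to \<open>x\<close> for every fixed \<open>s\<close>.
\<close>

lemma gauss_smoothing_tendsto:
  assumes u: "continuous_on {-1..1} u" and x: "x \<in> I1"
  shows "(\<lambda>k. \<integral>y. u y * gauss_kernel (real (Suc k)) (x - y) \<partial>lebesgue_on I1) \<longlonglongrightarrow> u x"
proof -
  have meas: "(\<lambda>y. indicator I1 y * u y) \<in> borel_measurable borel"
    using borel_measurable_continuous_on_indicator[OF _ continuous_on_subset[OF u], of I1]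
    by (simp add: greaterThanLessThan_subseteq_atLeastAtMost_iff)
  obtain C where C: "C > 0" "\<And>x. x \<in> {-1..1} \<Longrightarrow> \<bar>u x\<bar> \<le> C"
    using continuous_on_I1_bounded[OF u] by blast
  have "(\<lambda>k. \<integral>s. indicator I1 (x - s / real (Suc k)) * u (x - s / real (Suc k)) * std_normal_density s \<partial>lborel)
      \<longlonglongrightarrow> (\<integral>s. u x * std_normal_density s \<partial>lborel)"
  proof (rule integral_dominated_convergence)
    show "integrable lborel (\<lambda>s. C * std_normal_density s)"
      by simp
    show "(\<lambda>s. indicator I1 (x - s / real (Suc k)) * u (x - s / real (Suc k)) * std_normal_density s) \<in> borel_measurable lborel" for k
      using measurable_compose[OF _ meas, of "\<lambda>s. x - s / real (Suc k)" borel] by simp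
    show "AE s in lborel. norm (indicator I1 (x - s / real (Suc k)) * u (x - s / real (Suc k)) * std_normal_density s)
        \<le> C * std_normal_density s" for k
    proof (intro AE_I2)
      fix s
      have "\<bar>indicator I1 t * u t\<bar> \<le> C" for t
        using C by (auto simp: indicator_def)
      then show "norm (indicator I1 (x - s / real (Suc k)) * u (x - s / real (Suc k)) * std_normal_density s) \<le> C * std_normal_density s"
        using C(1) unfolding real_norm_def abs_mult[of _ "std_normal_density s"]
        by (intro mult_mono) auto
    qed
    show "AE s in lborel. (\<lambda>k. indicator I1 (x - s / real (Suc k)) * u (x - s / real (Suc k)) * std_normal_density s)
        \<longlonglongrightarrow> u x * std_normal_density s"
    proof (intro AE_I2 tendsto_mult_right)
      fix s :: real
      have "(\<lambda>k. x - s * inverse (real (Suc k))) \<longlonglongrightarrow> x - s * 0"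
        by (intro tendsto_intros LIMSEQ_inverse_real_of_nat)
      then have lim: "(\<lambda>k. x - s / real (Suc k)) \<longlonglongrightarrow> x"
        by (simp add: divide_inverse)
      have "isCont u x"
        using u x continuous_on_interior[of "{-1..1}" u x] by simp
      then have "(\<lambda>k. u (x - s / real (Suc k))) \<longlonglongrightarrow> u x"
        using lim by (rule isCont_tendsto_compose)
      moreover have "\<forall>\<^sub>F k in sequentially. x - s / real (Suc k) \<in> I1"
        using topological_tendstoD[OF lim _ x] by simp
      ultimately show "(\<lambda>k. indicator I1 (x - s / real (Suc k)) * u (x - s / real (Suc k))) \<longlonglongrightarrow> u x"
        by (elim Lim_transform_eventually eventually_mono) simp
    qed
  qed simp
  then show ?thesis
    by (simp add: integral_gauss_kernel[OF _ meas])
qed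

text \<open>
  The other half of the Plancherel theorem, for functions continuous up to the boundary.
\<close>

lemma gauss_energy_tendsto:
  assumes u: "continuous_on {-1..1} u"
  shows "(\<lambda>k. gauss_energy (real (Suc k)) u) \<longlonglongrightarrow> (\<integral>x. (u x)\<^sup>2 \<partial>lebesgue_on I1)"
proof -
  let ?N = "lebesgue_on I1" and ?P = "\<lambda>k x. \<integral>y. u y * gauss_kernel (real (Suc k)) (x - y) \<partial>lebesgue_on I1"
  interpret N: finite_measure ?N by (rule finite_measure_I1)
  obtain C where C: "C > 0" "\<And>x. x \<in> {-1..1} \<Longrightarrow> \<bar>u x\<bar> \<le> C"
    using continuous_on_I1_bounded[OF u] by blast
  have [measurable]: "u \<in> borel_measurable ?N"
    by (intro borel_measurable_I1_continuous continuous_on_subset[OF u]) auto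
  have ui: "integrable ?N u"
    by (rule integrable_bounded_I1[of _ C]) (use C(2) in auto)
  have [measurable]: "snd \<in> borel_measurable (?N \<Otimes>\<^sub>M ?N)" "fst \<in> borel_measurable (?N \<Otimes>\<^sub>M ?N)"
    by (rule measurable_compose[OF measurable_snd measurable_id_I1] measurable_compose[OF measurable_fst measurable_id_I1])+
  have [measurable]: "(\<lambda>x. x) \<in> borel_measurable ?N"
    by (rule measurable_id_I1)
  have P_le: "\<bar>?P k x\<bar> \<le> C" for k x
  proof -
    have "\<bar>?P k x\<bar> \<le> (\<integral>y. \<bar>u y * gauss_kernel (real (Suc k)) (x - y)\<bar> \<partial>?N)"
      by (rule integral_abs_bound)
    also have "\<dots> \<le> (\<integral>y. C * gauss_kernel (real (Suc k)) (x - y) \<partial>?N)"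
    proof (rule integral_mono')
      show "integrable ?N (\<lambda>y. C * gauss_kernel (real (Suc k)) (x - y))"
        using gauss_kernel_nonneg[of "real (Suc k)"] gauss_kernel_le[of "real (Suc k)"]
        by (intro integrable_mult_right integrable_bounded_I1[of _ "real (Suc k)"]) auto
    qed (use C gauss_kernel_nonneg[of "real (Suc k)"] in \<open>auto simp: abs_mult intro!: mult_right_mono mult_nonneg_nonneg\<close>)
    also have "\<dots> \<le> C * 1"
      using C(1) integral_gauss_kernel_le_1[of "real (Suc k)" x] by (simp del: of_nat_Suc)
    finally show ?thesis
      by simp
  qed
  have "(\<lambda>k. \<integral>x. u x * ?P k x \<partial>?N) \<longlonglongrightarrow> (\<integral>x. u x * u x \<partial>?N)"
  proof (rule integral_dominated_convergence)
    show "integrable ?N (\<lambda>x. C * C)"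
      by simp
    show "AE x in ?N. (\<lambda>k. u x * ?P k x) \<longlonglongrightarrow> u x * u x"
      by (intro AE_I2 tendsto_mult_left gauss_smoothing_tendsto[OF u]) simp
    show "AE x in ?N. norm (u x * ?P k x) \<le> C * C" for k
      using C P_le by (auto simp: abs_mult simp del: of_nat_Suc intro!: AE_I2 mult_mono)
    show "(\<lambda>x. u x * ?P k x) \<in> borel_measurable ?N" for k
      by measurable
  qed simp
  then show ?thesis
    by (simp add: gauss_energy_eq[OF ui] power2_eq_square mult.assoc del: of_nat_Suc)
qed

section \<open>Splitting off the high frequencies\<close>

lemma L2_norm_on_square:
  "(L2_norm_on S f)\<^sup>2 = (\<integral>x. (norm (f x))\<^sup>2 \<partial>lebesgue_on S)"
  by (simp add: L2_norm_on_def)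

lemma L2_norm_truncated_fourier:
  assumes h: "integrable (lebesgue_on I1) h"
  shows "(L2_norm_on {-B<..<B} (truncated_fourier B h))\<^sup>2 =
      (\<integral>\<xi>. indicator {-B<..<B} \<xi> * (norm (fourier h \<xi>))\<^sup>2 \<partial>lborel)"
    and "integrable lborel (\<lambda>\<xi>. indicator {-B<..<B} \<xi> * (norm (fourier h \<xi>))\<^sup>2)"
proof -
  have [measurable]: "fourier h \<in> borel_measurable borel"
    using h by (intro borel_measurable_fourier) simp
  have "(L2_norm_on {-B<..<B} (truncated_fourier B h))\<^sup>2 =
      (\<integral>\<xi>. indicator {-B<..<B} \<xi> * (norm (truncated_fourier B h \<xi>))\<^sup>2 \<partial>lebesgue)"
    by (simp add: L2_norm_on_square integral_restrict_space)
  also have "\<dots> = (\<integral>\<xi>. indicator {-B<..<B} \<xi> * (norm (fourier h \<xi>))\<^sup>2 \<partial>lebesgue)"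
    by (intro Bochner_Integration.integral_cong) (auto simp: truncated_fourier_def indicator_def)
  also have "\<dots> = (\<integral>\<xi>. indicator {-B<..<B} \<xi> * (norm (fourier h \<xi>))\<^sup>2 \<partial>lborel)"
    by (subst integral_completion) auto
  finally show "(L2_norm_on {-B<..<B} (truncated_fourier B h))\<^sup>2 =
      (\<integral>\<xi>. indicator {-B<..<B} \<xi> * (norm (fourier h \<xi>))\<^sup>2 \<partial>lborel)" .
  let ?c = "1 / sqrt (2 * pi) * (\<integral>x. \<bar>h x\<bar> \<partial>lebesgue_on I1)"
  show "integrable lborel (\<lambda>\<xi>. indicator {-B<..<B} \<xi> * (norm (fourier h \<xi>))\<^sup>2)"
  proof (rule Bochner_Integration.integrable_bound)
    show "integrable lborel (\<lambda>\<xi>. ?c\<^sup>2 * indicator {-B<..<B} \<xi>)"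
      by (intro integrable_mult_right integrable_real_indicator emeasure_bounded_finite) auto
    show "AE \<xi> in lborel. norm (indicator {-B<..<B} \<xi> * (norm (fourier h \<xi>))\<^sup>2) \<le> norm (?c\<^sup>2 * indicator {-B<..<B} \<xi>)"
      using power_mono[OF norm_fourier_le norm_ge_zero, of h _ 2]
      by (intro AE_I2) (auto simp: indicator_def)
  qed measurable
qed

lemma L2_norm_truncated_fourier_le:
  assumes h: "integrable (lebesgue_on I1) h" and B: "B > 0"
  shows "(L2_norm_on {-B<..<B} (truncated_fourier B h))\<^sup>2
    \<le> 2 * B * (1 / sqrt (2 * pi) * (\<integral>x. \<bar>h x\<bar> \<partial>lebesgue_on I1))\<^sup>2"
proof -
  let ?c = "1 / sqrt (2 * pi) * (\<integral>x. \<bar>h x\<bar> \<partial>lebesgue_on I1)"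
  have "(L2_norm_on {-B<..<B} (truncated_fourier B h))\<^sup>2 \<le> (\<integral>\<xi>. ?c\<^sup>2 * indicator {-B<..<B} \<xi> \<partial>lborel)"
    unfolding L2_norm_truncated_fourier(1)[OF h]
  proof (rule integral_mono[OF L2_norm_truncated_fourier(2)[OF h]])
    show "integrable lborel (\<lambda>\<xi>. ?c\<^sup>2 * indicator {-B<..<B} \<xi>)"
      by (intro integrable_mult_right integrable_real_indicator emeasure_bounded_finite) auto
    show "indicator {-B<..<B} \<xi> * (norm (fourier h \<xi>))\<^sup>2 \<le> ?c\<^sup>2 * indicator {-B<..<B} \<xi>" for \<xi>
      using power_mono[OF norm_fourier_le norm_ge_zero, of h \<xi> 2] by (auto simp: indicator_def)
  qed
  also have "\<dots> = 2 * B * ?c\<^sup>2"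
    using B by simp
  finally show ?thesis .
qed

text \<open>
  For \<open>|\<xi>| < B\<close> the Gaussian weight is at most \<open>1\<close>; for \<open>|\<xi>| \<ge> B\<close> one has
  \<open>|\<close>\<open>fourier f \<xi>\<close>\<open>|\<^sup>2 \<le> |\<close>\<open>fourier g \<xi>\<close>\<open>|\<^sup>2 / B\<^sup>2\<close>.
\<close>

lemma gauss_energy_le_low_frequencies:
  assumes f: "integrable (lebesgue_on I1) f" and g: "integrable (lebesgue_on I1) g"
    and fg: "\<And>\<xi>. norm (fourier g \<xi>) = \<bar>\<xi>\<bar> * norm (fourier f \<xi>)" and B: "B > 0" and n: "n > 0"
  shows "gauss_energy n f \<le> (L2_norm_on {-B<..<B} (truncated_fourier B f))\<^sup>2 + gauss_energy n g / B\<^sup>2"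
proof -
  let ?M = std_normal_distribution
  let ?\<psi> = "\<lambda>\<xi>. indicator {-B<..<B} \<xi> * (norm (fourier f \<xi>))\<^sup>2"
  have [measurable]: "fourier f \<in> borel_measurable borel" "fourier g \<in> borel_measurable borel"
    using f g by (auto intro: borel_measurable_fourier)
  have int: "integrable ?M (\<lambda>s. (norm (fourier h (n * s)))\<^sup>2)"
    if "fourier h \<in> borel_measurable borel" for h
  proof (rule std_normal.integrable_const_bound)
    show "AE s in ?M. norm ((norm (fourier h (n * s)))\<^sup>2) \<le> (1 / sqrt (2 * pi) * (\<integral>x. \<bar>h x\<bar> \<partial>lebesgue_on I1))\<^sup>2"
      using power_mono[OF norm_fourier_le norm_ge_zero, of h _ 2] by (intro AE_I2) auto
  qed (use that in measurable)
  have \<psi>_int: "integrable lborel ?\<psi>"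
    by (rule L2_norm_truncated_fourier(2)[OF f])
  have \<psi>_nint: "integrable lborel (\<lambda>s. ?\<psi> (n * s))"
    using lborel_integrable_real_affine[OF \<psi>_int, of n 0] n by simp
  have \<psi>_Mint: "integrable ?M (\<lambda>s. ?\<psi> (n * s))"
    by (rule Bochner_Integration.integrable_bound[OF int[of f]]) (auto simp: indicator_def)
  have "(\<integral>s. (norm (fourier f (n * s)))\<^sup>2 \<partial>?M) \<le> (\<integral>s. ?\<psi> (n * s) + (norm (fourier g (n * s)))\<^sup>2 / B\<^sup>2 \<partial>?M)"
  proof (rule integral_mono)
    show "integrable ?M (\<lambda>s. (norm (fourier f (n * s)))\<^sup>2)"
      by (rule int) measurable
    show "integrable ?M (\<lambda>s. ?\<psi> (n * s) + (norm (fourier g (n * s)))\<^sup>2 / B\<^sup>2)"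
      by (intro Bochner_Integration.integrable_add \<psi>_Mint integrable_divide int) measurable
    fix s
    show "(norm (fourier f (n * s)))\<^sup>2 \<le> ?\<psi> (n * s) + (norm (fourier g (n * s)))\<^sup>2 / B\<^sup>2"
    proof (cases "n * s \<in> {-B<..<B}")
      case False
      then have "B\<^sup>2 \<le> \<bar>n * s\<bar>\<^sup>2"
        using B by (intro power_mono) auto
      then have "(norm (fourier f (n * s)))\<^sup>2 * B\<^sup>2 \<le> (norm (fourier f (n * s)))\<^sup>2 * \<bar>n * s\<bar>\<^sup>2"
        by (intro mult_left_mono) auto
      then show ?thesis
        using False B by (simp add: fg power_mult_distrib field_simps del: power2_abs)
    qed simp
  qed
  also have "\<dots> = (\<integral>s. ?\<psi> (n * s) \<partial>?M) + (\<integral>s. (norm (fourier g (n * s)))\<^sup>2 \<partial>?M) / B\<^sup>2"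
    by (subst Bochner_Integration.integral_add) (use \<psi>_Mint int[of g] in auto)
  finally have "gauss_energy n f \<le> n * sqrt (2 * pi) *
      ((\<integral>s. ?\<psi> (n * s) \<partial>?M) + (\<integral>s. (norm (fourier g (n * s)))\<^sup>2 \<partial>?M) / B\<^sup>2)"
    unfolding gauss_energy_def using n by (intro mult_left_mono) auto
  also have "\<dots> = n * (sqrt (2 * pi) * (\<integral>s. ?\<psi> (n * s) \<partial>?M)) + gauss_energy n g / B\<^sup>2"
    by (simp add: gauss_energy_def field_simps)
  also have "sqrt (2 * pi) * (\<integral>s. ?\<psi> (n * s) \<partial>?M) \<le> (\<integral>s. ?\<psi> (n * s) \<partial>lborel)"
  proof -
    have "(\<integral>s. ?\<psi> (n * s) \<partial>?M) = (\<integral>s. std_normal_density s * ?\<psi> (n * s) \<partial>lborel)"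
      by (subst integral_density) auto
    also have "\<dots> = (\<integral>s. 1 / sqrt (2 * pi) * (exp (- s\<^sup>2 / 2) * ?\<psi> (n * s)) \<partial>lborel)"
      by (simp only: std_normal_density_def mult.assoc)
    finally have "sqrt (2 * pi) * (\<integral>s. ?\<psi> (n * s) \<partial>?M) = (\<integral>s. exp (- s\<^sup>2 / 2) * ?\<psi> (n * s) \<partial>lborel)"
      unfolding integral_mult_right_zero by simp
    also have "\<dots> \<le> (\<integral>s. ?\<psi> (n * s) \<partial>lborel)"
      by (rule integral_mono'[OF \<psi>_nint]) (auto intro!: mult_left_le_one_le)
    finally show ?thesis .
  qed
  also have "n * (\<integral>s. ?\<psi> (n * s) \<partial>lborel) = (\<integral>\<xi>. ?\<psi> \<xi> \<partial>lborel)"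
    using n lborel_integral_real_affine[of n ?\<psi> 0] by simp
  also have "\<dots> = (L2_norm_on {-B<..<B} (truncated_fourier B f))\<^sup>2"
    by (rule L2_norm_truncated_fourier(1)[OF f, symmetric])
  finally show ?thesis
    using n by simp
qed

lemma L2_norm_le_low_frequencies:
  assumes weak: "has_L2_weak_deriv I1 f g"
    and u: "continuous_on {-1..1} u" "u (-1) = 0" "u 1 = 0" "AE x in lebesgue_on I1. f x = u x"
    and B: "B > 0"
  shows "(L2_norm_on I1 f)\<^sup>2 \<le> (L2_norm_on {-B<..<B} (truncated_fourier B f))\<^sup>2 + (L2_norm_on I1 g)\<^sup>2 / B\<^sup>2"
proof -
  let ?N = "lebesgue_on I1"
  have g: "g \<in> L2_space I1" and i: "integrable ?N f" "integrable ?N g"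
    using weak L2_imp_integrable by (auto simp: has_L2_weak_deriv_def)
  have um: "u \<in> borel_measurable ?N"
    by (intro borel_measurable_I1_continuous continuous_on_subset[OF u(1)]) auto
  have fm: "f \<in> borel_measurable ?N"
    using i by simp
  note [measurable] = um fm measurable_id_I1
  have "fourier f = fourier u"
  proof
    fix \<xi>
    show "fourier f \<xi> = fourier u \<xi>"
      unfolding fourier_def
      by (intro arg_cong2[where f="(*)"] refl integral_cong_AE) (measurable, use u(4) in auto)
  qed
  then have E: "gauss_energy n f = gauss_energy n u" for n
    by (simp add: gauss_energy_def)
  have "(L2_norm_on I1 f)\<^sup>2 = (\<integral>x. (u x)\<^sup>2 \<partial>?N)"
    unfolding L2_norm_on_square by (intro integral_cong_AE) (measurable, use u(4) in auto)
  moreover have "(\<lambda>k. gauss_energy (real (Suc k)) f) \<longlonglongrightarrow> (\<integral>x. (u x)\<^sup>2 \<partial>?N)"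
    unfolding E by (rule gauss_energy_tendsto[OF u(1)])
  moreover have "gauss_energy (real (Suc k)) f
      \<le> (L2_norm_on {-B<..<B} (truncated_fourier B f))\<^sup>2 + (L2_norm_on I1 g)\<^sup>2 / B\<^sup>2" for k
  proof -
    have "gauss_energy (real (Suc k)) f
      \<le> (L2_norm_on {-B<..<B} (truncated_fourier B f))\<^sup>2 + gauss_energy (real (Suc k)) g / B\<^sup>2"
      by (rule gauss_energy_le_low_frequencies[OF i _ B])
        (simp_all add: fourier_weak_deriv[OF weak u] norm_mult)
    also have "gauss_energy (real (Suc k)) g \<le> (L2_norm_on I1 g)\<^sup>2"
      using gauss_energy_le[OF g, of "real (Suc k)"] by (simp add: L2_norm_on_square)
    finally show ?thesis
      by (simp add: divide_right_mono)
  qed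
  ultimately show ?thesis
    by (auto intro: LIMSEQ_le_const2)
qed

theorem theorem1:
  fixes f :: "real \<Rightarrow> real"
  assumes "f \<in> sobolev_H10 (-1) 1"
    and "\<not> (AE x in lebesgue_on {-1<..<1}. f x = 0)"
  shows "(\<forall>B. B > frequency_number f \<longrightarrow>
            L2_norm_on {-1<..<1} f
              \<le> (1 - (frequency_number f)\<^sup>2 / B\<^sup>2) powr (- 1 / 2)
                  * L2_norm_on {-B<..<B} (truncated_fourier B f)) \<and>
         (\<forall>\<gamma> B. \<gamma> > 1 \<longrightarrow> B \<ge> sqrt \<gamma> * frequency_number f \<longrightarrow>
            L2_norm_on {-1<..<1} f
              \<le> C_const \<gamma> * L2_norm_on {-B<..<B} (truncated_fourier B f))"
proof -
  let ?N = "lebesgue_on {-1<..<1::real}"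
  define g where "g = weak_deriv {-1<..<1} f"
  define \<omega> where "\<omega> = frequency_number f"
  let ?F = "\<lambda>B. L2_norm_on {-B<..<B} (truncated_fourier B f)"
  obtain g' where "has_L2_weak_deriv {-1<..<1} f g'"
    using assms(1) by (auto simp: sobolev_H10_def sobolev_H1_def)
  then have weak: "has_L2_weak_deriv {-1<..<1} f g"
    unfolding g_def weak_deriv_def
    by (rule someI[of "has_L2_weak_deriv {-1<..<1} f"])
  obtain u where u: "continuous_on {-1..1} u" "u (-1) = 0" "u 1 = 0" "AE x in ?N. f x = u x"
    using assms(1) unfolding sobolev_H10_def by blast
  have L2: "f \<in> L2_space {-1<..<1}"
    using weak unfolding has_L2_weak_deriv_def by blast
  have f: "integrable ?N f"
    by (rule L2_imp_integrable[OF L2])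
  have f2: "integrable ?N (\<lambda>x. (f x)\<^sup>2)"
    using L2 unfolding L2_space_def by blast
  have "(L2_norm_on {-1<..<1} f)\<^sup>2 \<noteq> 0"
    using assms(2) integral_nonneg_eq_0_iff_AE[OF f2] by (simp add: L2_norm_on_square)
  then have pos: "L2_norm_on {-1<..<1} f > 0"
    by (simp add: L2_norm_on_def less_le)
  have norm_g: "L2_norm_on {-1<..<1} g = \<omega> * L2_norm_on {-1<..<1} f"
    using pos by (simp add: \<omega>_def frequency_number_def g_def)
  have key: "(1 - \<omega>\<^sup>2 / B\<^sup>2) * (L2_norm_on {-1<..<1} f)\<^sup>2 \<le> (?F B)\<^sup>2" if "B > 0" for B
    using L2_norm_le_low_frequencies[OF weak u that] unfolding norm_g
    by (simp add: power_mult_distrib algebra_simps)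
  have F_nonneg: "?F B \<ge> 0" for B
    by (simp add: L2_norm_on_def)
  have main: "L2_norm_on {-1<..<1} f \<le> c powr (- 1 / 2) * ?F B"
    if c: "0 < c" "c * (L2_norm_on {-1<..<1} f)\<^sup>2 \<le> (?F B)\<^sup>2" for c B
  proof -
    have "(sqrt c * L2_norm_on {-1<..<1} f)\<^sup>2 \<le> (?F B)\<^sup>2"
      using c by (simp add: power_mult_distrib)
    then have "sqrt c * L2_norm_on {-1<..<1} f \<le> ?F B"
      using F_nonneg by (rule power2_le_imp_le)
    moreover have "c powr (- 1 / 2) = 1 / sqrt c"
      using c(1) by (metis divide_minus_left powr_minus powr_half_sqrt divide_inverse mult_1 less_imp_le)
    ultimately show ?thesis
      using c(1) by (simp add: pos_le_divide_eq mult.commute)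
  qed
  \<comment> \<open>If \<open>\<omega> = 0\<close>, the key inequality holds with factor \<open>1\<close> for every \<open>B > 0\<close>. Since the Fourier
    transform is bounded, its right-hand side is \<open>O(B)\<close>, so letting \<open>B\<close> tend to \<open>0\<close> gives \<open>f = 0\<close>.\<close>
  have "\<omega> \<noteq> 0"
  proof
    assume "\<omega> = 0"
    define D where "D = 2 * (1 / sqrt (2 * pi) * (\<integral>x. \<bar>f x\<bar> \<partial>?N))\<^sup>2"
    have le: "(L2_norm_on {-1<..<1} f)\<^sup>2 \<le> B * D" if "B > 0" for B
      using key[OF that] L2_norm_truncated_fourier_le[OF f that] \<open>\<omega> = 0\<close> by (simp add: D_def mult_ac)
    have "((\<lambda>B. B * D) \<longlongrightarrow> 0 * D) (at_right 0)"
      by (intro tendsto_intros)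
    then have "(L2_norm_on {-1<..<1} f)\<^sup>2 \<le> 0 * D"
      by (rule tendsto_lowerbound) (auto simp: eventually_at_filter le)
    with pos show False
      by simp
  qed
  then have \<omega>: "\<omega> > 0"
    by (simp add: \<omega>_def frequency_number_def L2_norm_on_def less_le)
  have ratio: "\<omega>\<^sup>2 / B\<^sup>2 < 1" if "B > \<omega>" for B
    using that \<omega> by (simp add: power_strict_mono)
  show ?thesis
    unfolding \<omega>_def[symmetric]
  proof (intro conjI allI impI)
    fix B assume "B > \<omega>"
    then show "L2_norm_on {-1<..<1} f \<le> (1 - \<omega>\<^sup>2 / B\<^sup>2) powr (- 1 / 2) * ?F B"
      using ratio \<omega> by (intro main key) auto
  next
    fix \<gamma> B :: real assume \<gamma>: "\<gamma> > 1" and B: "B \<ge> sqrt \<gamma> * \<omega>"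
    have "sqrt \<gamma> * \<omega> > 0"
      using \<gamma> \<omega> by simp
    then have "B > 0"
      using B by linarith
    have "(sqrt \<gamma> * \<omega>)\<^sup>2 \<le> B\<^sup>2"
      using B \<gamma> \<omega> by (intro power_mono) auto
    then have "\<omega>\<^sup>2 / B\<^sup>2 \<le> 1 / \<gamma>"
      using \<gamma> \<open>B > 0\<close> by (simp add: power_mult_distrib field_simps)
    then have "(1 - 1 / \<gamma>) * (L2_norm_on {-1<..<1} f)\<^sup>2 \<le> (1 - \<omega>\<^sup>2 / B\<^sup>2) * (L2_norm_on {-1<..<1} f)\<^sup>2"
      by (intro mult_right_mono) auto
    also have "\<dots> \<le> (?F B)\<^sup>2"
      by (rule key[OF \<open>B > 0\<close>])
    finally show "L2_norm_on {-1<..<1} f \<le> C_const \<gamma> * ?F B"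
      unfolding C_const_def using \<gamma> by (intro main) auto
  qed
qed

end
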